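(* Let $f:\mathbb{R}^n\to\mathbb{R}$ and assume that at least one of the following holds: (i) $f$ is convex, $f$ is locally Lipschitz continuous, the set $\Omega^2$ of points at which $f$ is not twice differentiable is a Lebesgue null set, and for all $x\in\mathbb{R}^n$ there is an open set $V\ni x$ such that $\{\nabla^2 f(y): y\in V\setminus\Omega^2\}$ is bounded; or (ii) $f$ is of max-type: there are a finite set $I$ and $C^3$ functions $f_k:\mathbb{R}^n\to\mathbb{R}$, $k\in I$, with $f(x)=\max_{k\in I} f_k(x)$ for all $x\in\mathbb{R}^n$, and $f$ is $C^2$ at every point at which it is differentiable. Let $x^0\in\mathbb{R}^n$, let $c\in(0,1)$, and let $(\varepsilon_j)_{j\in\mathbb{N}},(\tau_j)_{j\in\mathbb{N}}$ be sequences of positive reals converging to $0$. Let $(x^j)_j$ and $(\hat{x}^l)_l$ be the sequences generated by the practical descent method (defined in the context) with these inputs. If the level set $\{y\in\mathbb{R}^n: f(y)\le f(x^0)\}$ is bounded, then $(x^j)_j$ has an accumulation point $x^*\in\mathbb{R}^n$ and all accumulation points of $(x^j)_j$ are critical points of $f$. Furthermore, $f(\hat{x}^l)\to f(x^* )$ as $l\to\infty$.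
   Context: Notation. $\|\cdot\|$ is the Euclidean norm and $B_\delta(x)=\{y\in\mathbb{R}^n:\|x-y\|\le\delta\}$. $f$ is $C^2$ at a point if it is twice continuously differentiable on an open neighborhood of that point. $\Omega$ is the set of points where $f$ is not differentiable, $\Omega^2$ the set of points where $f$ is not twice differentiable. The Clarke subdifferential is $\partial f(x)=\mathrm{conv}\{\xi\in\mathbb{R}^n:\exists (y^i)_i\subset\mathbb{R}^n\setminus\Omega,\ y^i\to x,\ \nabla f(y^i)\to\xi\}$; a point $x$ is critical if $0\in\partial f(x)$. Second-order $\varepsilon$-jet. For $x\in\mathbb{R}^n$, $\varepsilon\ge0$, $$\mathcal{J}^2_\varepsilon f(x)=\bigcap_{\delta>\varepsilon}\overline{\{(y,f(y),\nabla f(y),\nabla^2 f(y)): y\in B_\delta(x)\setminus\Omega^2\}}\subseteq\mathbb{R}^n\times\mathbb{R}\times\mathbb{R}^n\times\mathbb{R}^{n\times n}.$$ Model. For a finite nonempty $W\subseteq\mathcal{J}^2_\varepsilon f(x)$ let $$\mathcal{T}^W_{x,\varepsilon}(z)=\max_{(y,f(y),\xi,\mathcal{H})\in W} f(y)+\xi^\top(z-y)+\tfrac12(z-y)^\top\mathcal{H}(z-y),$$ let $\bar z^W(x,\varepsilon)$ be an arbitrary (global) minimizer of $\mathcal{T}^W_{x,\varepsilon}$ over $B_\varepsilon(x)$, and let $\theta^W(x,\varepsilon)=\mathcal{T}^W_{x,\varepsilon}(\bar z^W(x,\varepsilon))$ be the minimal value. Sampling scheme (inputs $x\in\mathbb{R}^n$,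 $c\in(0,1)$, $\varepsilon>0$, $\tau>0$): 1. Pick an arbitrary element $J_x=(x,f(x),\xi_x,\mathcal{H}_x)\in\mathcal{J}^2_0 f(x)$ and set $W=\{J_x\}$. 2. Compute $\theta^W=\theta^W(x,\varepsilon)$ and $\bar z^W=\bar z^W(x,\varepsilon)$. 3. If $(\theta^W-f(x))/\varepsilon>-\tau$ or $f(\bar z^W)\le c\,\theta^W+(1-c)f(x)$, stop (returning $\theta^W$ and $\bar z^W$). 4. Otherwise pick an arbitrary element $J_{\bar z^W}\in\mathcal{J}^2_0 f(\bar z^W)$, replace $W$ by $W\cup\{J_{\bar z^W}\}$, and go to 2. Practical descent method (inputs $x^0$, $(\varepsilon_j)_j$, $(\tau_j)_j$, $c$): 1. Set $j=1$, $i=0$, $x^{1,0}=x^0$. 2. Run the sampling scheme with inputs $x^{j,i},c,\varepsilon_j,\tau_j$ and let $\theta^{j,i}=\theta^W(x^{j,i},\varepsilon_j)$, $\bar z^{j,i}=\bar z^W(x^{j,i},\varepsilon_j)$ be the values it returns (for the final $W$). 3. If $(\theta^{j,i}-f(x^{j,i}))/\varepsilon_j>-\tau_j$, set $x^{j+1,0}=x^{j,i}$, then $j\leftarrow j+1$, $i\leftarrow0$. 4. Else set $x^{j,i+1}=\bar z^{j,i}$ and $i\leftarrow i+1$. 5. Go to 2. For each $j$, let $N_j\in\mathbb{N}\cup\{0,\infty\}$ be the number of descent steps (executions of step 4) performed for this $j$; set $x^j:=x^{j,N_j}=x^{j+1,0}$ (if $N_j=\infty$ for some $j$, then $(x^j)_j$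 is a finite sequence). The sequence of all iterates is $(\hat x^l)_l=(x^{1,0},x^{1,1},\dots,x^{1,N_1},x^{2,0},x^{2,1},\dots,x^{2,N_2},\dots)$. *)

theory Defs
  imports "HOL-Analysis.Analysis"
begin

definition gradient :: "(real^'n \<Rightarrow> real) \<Rightarrow> real^'n \<Rightarrow> real^'n" where
  "gradient f x = (THE g. GDERIV f x :> g)"

definition hessian :: "(real^'n \<Rightarrow> real) \<Rightarrow> real^'n \<Rightarrow> real^'n^'n" where
  "hessian f x = jacobian (gradient f) (at x)"

text \<open>Twice differentiability at a point is meant in the usual (Frechet) sense; differentiability
  near \<open>x\<close> is required because \<^const>\<open>gradient\<close> is only meaningful where the gradient exists.\<close>

definition twice_differentiable_at :: "(real^'n \<Rightarrow> real) \<Rightarrow> real^'n \<Rightarrow> bool" where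
  "twice_differentiable_at f x \<longleftrightarrow>
     (\<forall>\<^sub>F y in nhds x. f differentiable (at y)) \<and> gradient f differentiable (at x)"

definition Omega :: "(real^'n \<Rightarrow> real) \<Rightarrow> (real^'n) set" where
  "Omega f = {x. \<not> f differentiable (at x)}"

definition Omega2 :: "(real^'n \<Rightarrow> real) \<Rightarrow> (real^'n) set" where
  "Omega2 f = {x. \<not> twice_differentiable_at f x}"

definition C2_at :: "(real^'n \<Rightarrow> real) \<Rightarrow> real^'n \<Rightarrow> bool" where
  "C2_at f x \<longleftrightarrow> (\<exists>U. open U \<and> x \<in> U \<and> (\<forall>y\<in>U. twice_differentiable_at f y) \<and>
     continuous_on U (hessian f))"

text \<open>\<open>D x\<close> is the third derivative, as the bounded linear derivative of the Hessian at \<open>x\<close>.\<close>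

definition C3 :: "(real^'n \<Rightarrow> real) \<Rightarrow> bool" where
  "C3 f \<longleftrightarrow> (\<forall>x. twice_differentiable_at f x) \<and>
     (\<exists>D :: real^'n \<Rightarrow> (real^'n) \<Rightarrow>\<^sub>L (real^'n^'n).
        (\<forall>x. (hessian f has_derivative blinfun_apply (D x)) (at x)) \<and> continuous_on UNIV D)"

definition locally_lipschitz :: "(real^'n \<Rightarrow> real) \<Rightarrow> bool" where
  "locally_lipschitz f \<longleftrightarrow> (\<forall>x. \<exists>U L. open U \<and> x \<in> U \<and> L-lipschitz_on U f)"

definition clarke_subdifferential :: "(real^'n \<Rightarrow> real) \<Rightarrow> real^'n \<Rightarrow> (real^'n) set" where
  "clarke_subdifferential f x = convex hull
     {\<xi>. \<exists>y :: nat \<Rightarrow> real^'n. (\<forall>i. y i \<notin> Omega f) \<and> y \<longlonglongrightarrow> x \<and> (\<lambda>i. gradient f (y i)) \<longlonglongrightarrow> \<xi>}"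

definition critical_point :: "(real^'n \<Rightarrow> real) \<Rightarrow> real^'n \<Rightarrow> bool" where
  "critical_point f x \<longleftrightarrow> 0 \<in> clarke_subdifferential f x"

definition accumulation_point :: "(nat \<Rightarrow> real^'n) \<Rightarrow> real^'n \<Rightarrow> bool" where
  "accumulation_point u a \<longleftrightarrow> (\<exists>r. strict_mono r \<and> (u \<circ> r) \<longlonglongrightarrow> a)"

type_synonym 'n jet = "(real^'n) \<times> real \<times> (real^'n) \<times> (real^'n^'n)"

definition jet2 :: "real \<Rightarrow> (real^'n \<Rightarrow> real) \<Rightarrow> real^'n \<Rightarrow> 'n jet set" where
  "jet2 \<epsilon> f x = (\<Inter>\<delta>\<in>{\<epsilon><..}.
     closure ((\<lambda>y. (y, f y, gradient f y, hessian f y)) ` (cball x \<delta> - Omega2 f)))"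

definition model :: "'n jet set \<Rightarrow> real^'n \<Rightarrow> real" where
  "model W z = Max ((\<lambda>(y, v, \<xi>, H).
     v + \<xi> \<bullet> (z - y) + 1/2 * ((z - y) \<bullet> (H *v (z - y)))) ` W)"

definition model_minimizer :: "'n jet set \<Rightarrow> real^'n \<Rightarrow> real \<Rightarrow> real^'n \<Rightarrow> bool" where
  "model_minimizer W x \<epsilon> z \<longleftrightarrow> is_arg_min (model W) (\<lambda>w. w \<in> cball x \<epsilon>) z"

definition sampling_stop ::
  "(real^'n \<Rightarrow> real) \<Rightarrow> real^'n \<Rightarrow> real \<Rightarrow> real \<Rightarrow> real \<Rightarrow> 'n jet set \<Rightarrow> real^'n \<Rightarrow> bool" where
  "sampling_stop f x c \<epsilon> \<tau> W z \<longleftrightarrow>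
     (model W z - f x) / \<epsilon> > - \<tau> \<or> f z \<le> c * model W z + (1 - c) * f x"

text \<open>A complete execution of the sampling scheme: \<open>W k\<close> and \<open>z k\<close> are the jet set and the model
  minimizer in pass \<open>k\<close>, and \<open>m\<close> is the pass in which the scheme stops (\<open>\<infinity>\<close> if it never does).
  Values at indices above \<open>m\<close> are irrelevant.\<close>

definition sampling_execution ::
  "(real^'n \<Rightarrow> real) \<Rightarrow> real^'n \<Rightarrow> real \<Rightarrow> real \<Rightarrow> real \<Rightarrow>
   (nat \<Rightarrow> 'n jet set) \<Rightarrow> (nat \<Rightarrow> real^'n) \<Rightarrow> enat \<Rightarrow> bool" where
  "sampling_execution f x c \<epsilon> \<tau> W z m \<longleftrightarrow>
     (\<exists>\<xi> H. (x, f x, \<xi>, H) \<in> jet2 0 f x \<and> W 0 = {(x, f x, \<xi>, H)}) \<and>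
     (\<forall>k. enat k \<le> m \<longrightarrow> model_minimizer (W k) x \<epsilon> (z k)) \<and>
     (\<forall>k. enat k < m \<longrightarrow> \<not> sampling_stop f x c \<epsilon> \<tau> (W k) (z k) \<and>
        (\<exists>J \<in> jet2 0 f (z k). W (Suc k) = W k \<union> {J})) \<and>
     (\<forall>k. m = enat k \<longrightarrow> sampling_stop f x c \<epsilon> \<tau> (W k) (z k))"

definition sampling_returns ::
  "(real^'n \<Rightarrow> real) \<Rightarrow> real^'n \<Rightarrow> real \<Rightarrow> real \<Rightarrow> real \<Rightarrow> real \<Rightarrow> real^'n \<Rightarrow> bool" where
  "sampling_returns f x c \<epsilon> \<tau> \<theta> zbar \<longleftrightarrow>
     (\<exists>W z k. sampling_execution f x c \<epsilon> \<tau> W z (enat k) \<and> \<theta> = model (W k) (z k) \<and> zbar = z k)"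

definition sampling_diverges ::
  "(real^'n \<Rightarrow> real) \<Rightarrow> real^'n \<Rightarrow> real \<Rightarrow> real \<Rightarrow> real \<Rightarrow> bool" where
  "sampling_diverges f x c \<epsilon> \<tau> \<longleftrightarrow> (\<exists>W z. sampling_execution f x c \<epsilon> \<tau> W z \<infinity>)"

text \<open>A state \<open>(j, i, x)\<close> of the descent method records that the current iterate
  \<open>x\<close> is the one with double index \<open>j,i\<close>.\<close>

type_synonym 'n dstate = "nat \<times> nat \<times> (real^'n)"

definition descent_pass ::
  "(real^'n \<Rightarrow> real) \<Rightarrow> real \<Rightarrow> (nat \<Rightarrow> real) \<Rightarrow> (nat \<Rightarrow> real) \<Rightarrow> 'n dstate \<Rightarrow> 'n dstate \<Rightarrow> bool" where
  "descent_pass f c \<epsilon> \<tau> = (\<lambda>(j, i, x) t'. \<exists>\<theta> z. sampling_returns f x c (\<epsilon> j) (\<tau> j) \<theta> z \<and>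
     t' = (if (\<theta> - f x) / \<epsilon> j > - \<tau> j then (Suc j, 0, x) else (j, Suc i, z)))"

text \<open>A complete execution of the descent method: \<open>s l\<close> is the state before pass \<open>l\<close>.
  The method itself has no stopping criterion, so \<open>L = \<infinity>\<close> unless the sampling scheme called
  in some pass \<open>L\<close> never returns, in which case no state after \<open>s L\<close> is ever reached.\<close>

definition practical_descent ::
  "(real^'n \<Rightarrow> real) \<Rightarrow> real^'n \<Rightarrow> real \<Rightarrow> (nat \<Rightarrow> real) \<Rightarrow> (nat \<Rightarrow> real) \<Rightarrow>
   (nat \<Rightarrow> 'n dstate) \<Rightarrow> enat \<Rightarrow> bool" where
  "practical_descent f x0 c \<epsilon> \<tau> s L \<longleftrightarrow>
     s 0 = (1, 0, x0) \<and>
     (\<forall>l. enat l < L \<longrightarrow> descent_pass f c \<epsilon> \<tau> (s l) (s (Suc l))) \<and>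
     (\<forall>l j i x. L = enat l \<and> s l = (j, i, x) \<longrightarrow> sampling_diverges f x c (\<epsilon> j) (\<tau> j))"

text \<open>The number of descent steps performed for \<open>j\<close>: these are exactly the passes that start with
  outer index \<open>j\<close> and do not increment it.\<close>

definition num_descent_steps :: "(nat \<Rightarrow> 'n dstate) \<Rightarrow> enat \<Rightarrow> nat \<Rightarrow> enat" where
  "num_descent_steps s L j =
     (let P = {l. enat l < L \<and> fst (s l) = j \<and> fst (s (Suc l)) = j}
      in if finite P then enat (card P) else \<infinity>)"

text \<open>Each double index occurs in at most one state of an execution, so the description is unique
  whenever the iterate exists.\<close>

definition iterate :: "(nat \<Rightarrow> 'n dstate) \<Rightarrow> enat \<Rightarrow> nat \<Rightarrow> nat \<Rightarrow> real^'n" where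
  "iterate s L j i = (THE x. \<exists>l. enat l \<le> L \<and> s l = (j, i, x))"

definition outer_iterate :: "(nat \<Rightarrow> 'n dstate) \<Rightarrow> enat \<Rightarrow> nat \<Rightarrow> real^'n" where
  "outer_iterate s L j = iterate s L (Suc j) 0"

text \<open>The pass ending outer index \<open>j\<close> leaves the iterate unchanged, so listing the iterates
  state by state repeats it, once as the last iterate for \<open>j\<close> and once as the first for
  \<open>Suc j\<close>.\<close>

definition all_iterates :: "(nat \<Rightarrow> 'n dstate) \<Rightarrow> nat \<Rightarrow> real^'n" where
  "all_iterates s l = snd (snd (s l))"

end

(* Both classes of functions are locally weakly convex with locally bounded gradients and Hessians:
   off a set with dense complement, f z >= f y + grad f(y).(z - y) - M |z - y|^2 locally uniformly.
   For max-type functions this is Taylor's formula for an index k whose set {f = f_k} has interior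
   accumulating at y.

   Sampling terminates: otherwise the minimal values theta_k increase to some t, and along a
   convergent subsequence of the minimizers z_k the newly added local models force t >= lim f(z_k),
   whereas failure of the stopping test gives lim f(z_k) >= c t + (1 - c) f(x) with t < f(x).
   Each descent step for j lowers f by at least c tau_j eps_j, so there are finitely many for each j.

   By weak convexity a model over B_eps(x) exceeds f by at most O(eps^2). Hence when the j-th stage
   ends, f >= f(x^j) - eps_j (tau_j + O(eps_j)) on B_(eps_j)(x^j). If an accumulation point were not
   critical, separating 0 from the Clarke subdifferential would give a direction in which f drops
   by at least b h - O(h^2) for every step h, uniformly near that point, a contradiction. *)

theory Submission
  imports Defs
begin

section \<open>Gradients and Hessians\<close>

lemma GDERIV_unique:
  fixes f :: "real^'n \<Rightarrow> real"
  assumes "GDERIV f x :> g" "GDERIV f x :> h"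
  shows "g = h"
proof -
  have "(\<lambda>v. v \<bullet> g) = (\<lambda>v. v \<bullet> h)"
    using assms unfolding gderiv_def by (rule has_derivative_unique)
  then show ?thesis by (metis vector_eq_ldot)
qed

lemma gradient_eqI:
  fixes f :: "real^'n \<Rightarrow> real"
  shows "GDERIV f x :> g \<Longrightarrow> gradient f x = g"
  unfolding gradient_def by (rule the_equality) (auto intro: GDERIV_unique)

lemma GDERIV_gradient:
  fixes f :: "real^'n \<Rightarrow> real"
  assumes "f differentiable (at x)"
  shows "GDERIV f x :> gradient f x"
proof -
  obtain D where D: "(f has_derivative D) (at x)"
    using assms by (auto simp: differentiable_def)
  have "linear D" using D by (rule has_derivative_linear)
  \<comment> \<open>\<open>adjoint D 1\<close> is the vector representing the linear functional
    \<open>D\<close>.\<close>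
  then have "D = (\<lambda>v. v \<bullet> adjoint D 1)"
    using adjoint_works[of D _ 1] by auto
  with D have "GDERIV f x :> adjoint D 1"
    by (simp add: gderiv_def)
  then show ?thesis by (simp add: gradient_eqI)
qed

lemma differentiable_of_notin_Omega2:
  "y \<notin> Omega2 f \<Longrightarrow> f differentiable (at y)"
  unfolding Omega2_def twice_differentiable_at_def by (auto dest: eventually_nhds_x_imp_x)

text \<open>Agreement on an open set makes the gradients agree on the whole set, hence also their
  derivatives at \<open>x\<close>. The operators \<open>gradient\<close> and \<open>hessian\<close>
  are descriptions, so equality of the defining predicates suffices. This transfers smoothness from
  a selected piece to a maximum.\<close>

lemma twice_differentiable_at_cong:
  fixes f g :: "real^'n \<Rightarrow> real"
  assumes "open U" "x \<in> U" and eq: "\<And>y. y \<in> U \<Longrightarrow> f y = g y"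
    and g: "twice_differentiable_at g x"
  shows "twice_differentiable_at f x" "hessian f x = hessian g x"
proof -
  have gd: "(f has_derivative D) (at y) \<longleftrightarrow> (g has_derivative D) (at y)" if "y \<in> U" for y D
    using has_derivative_transform_within_open[OF _ assms(1) that] eq by metis
  have gr: "gradient f y = gradient g y" if "y \<in> U" for y
    unfolding gradient_def gderiv_def using gd[OF that] by simp
  have hd: "(gradient f has_derivative D) (at x) \<longleftrightarrow> (gradient g has_derivative D) (at x)" for D
    using has_derivative_transform_within_open[OF _ assms(1,2)] gr by metis
  show "hessian f x = hessian g x"
    unfolding hessian_def jacobian_def frechet_derivative_def using hd by simp
  have "\<forall>\<^sub>F y in nhds x. g differentiable (at y)" "\<forall>\<^sub>F y in nhds x. y \<in> U"
    using g assms(1,2) eventually_nhds_in_open by (auto simp: twice_differentiable_at_def)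
  then have "\<forall>\<^sub>F y in nhds x. f differentiable (at y)"
    by eventually_elim (simp add: differentiable_def gd)
  then show "twice_differentiable_at f x"
    using g hd by (simp add: twice_differentiable_at_def differentiable_def)
qed

text \<open>The norm on the matrix type is the Euclidean norm of the entries, not the operator norm;
  boundedness of the bilinear product supplies a comparison constant \<open>K\<close>.\<close>

lemma matrix_vector_mult_bounded:
  obtains K :: real where "K > 0" "\<And>A (v::real^'n). norm ((A::real^'n^'m) *v v) \<le> norm A * norm v * K"
proof -
  have "bounded_bilinear ((*v) :: real^'n^'m \<Rightarrow> real^'n \<Rightarrow> real^'m)"
    unfolding bilinear_conv_bounded_bilinear[symmetric] bilinear_def
    by (auto intro!: linearI simp: matrix_vector_mult_add_rdistrib matrix_vector_right_distrib
        scaleR_matrix_vector_assoc matrix_vector_mult_scaleR)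
  from bounded_bilinear.pos_bounded[OF this] show thesis
    using that by blast
qed

text \<open>A bound on the Hessian makes the gradient Lipschitz with constant \<open>M\<close>, and
  a mean value point on the segment then controls the error of the linearization. Using a single
  mean value point gives the factor \<open>M\<close> instead of \<open>M / 2\<close>, which is
  harmless here.\<close>

lemma taylor_lower_bound:
  fixes g :: "real^'n \<Rightarrow> real"
  assumes "convex B" and td: "\<And>x. x \<in> B \<Longrightarrow> twice_differentiable_at g x"
    and b: "\<And>x v. x \<in> B \<Longrightarrow> norm (hessian g x *v v) \<le> M * norm v"
    and y: "y \<in> B" and z: "z \<in> B" and "0 \<le> M"
  shows "g z \<ge> g y + gradient g y \<bullet> (z - y) - M * (norm (z - y))\<^sup>2"
proof -
  have hd: "(gradient g has_derivative (*v) (hessian g x)) (at x)" if "x \<in> B" for x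
    using td[OF that] jacobian_works unfolding twice_differentiable_at_def hessian_def by metis
  have lip: "norm (gradient g w - gradient g y) \<le> M * norm (w - y)" if "w \<in> B" for w
  proof (rule differentiable_bound[OF assms(1) _ _ that y])
    show "(gradient g has_derivative (*v) (hessian g x)) (at x within B)" if "x \<in> B" for x
      using hd[OF that] by (rule has_derivative_at_withinI)
    show "onorm ((*v) (hessian g x)) \<le> M" if "x \<in> B" for x
      by (rule onorm_le) (use b[OF that] in blast)
  qed
  let ?p = "\<lambda>t. y + t *\<^sub>R (z - y)"
  have pB: "?p t \<in> B" if "0 \<le> t" "t \<le> 1" for t
    using convexD_alt[OF assms(1) y z that] by (simp add: algebra_simps)
  have "\<exists>t\<in>{0..1}. g (?p 1) - g (?p 0) = ((1 - 0) *\<^sub>R (z - y)) \<bullet> gradient g (?p t)"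
  proof (rule mvt_very_simple)
    fix t :: real assume "0 \<le> t" "t \<le> 1"
    then have "g differentiable (at (?p t))"
      using td[OF pB] by (auto simp: twice_differentiable_at_def dest: eventually_nhds_x_imp_x)
    then have "(g has_derivative (\<lambda>h. h \<bullet> gradient g (?p t))) (at (?p t))"
      using GDERIV_gradient by (simp add: gderiv_def)
    moreover have "(?p has_derivative (\<lambda>h. h *\<^sub>R (z - y))) (at t within {0..1})"
      by (auto intro!: derivative_eq_intros)
    ultimately show "((\<lambda>t. g (?p t)) has_derivative (\<lambda>h. (h *\<^sub>R (z - y)) \<bullet> gradient g (?p t))) (at t within {0..1})"
      by (rule has_derivative_compose[rotated])
  qed simp
  then obtain t where t: "0 \<le> t" "t \<le> 1" and eq: "g z - g y = (z - y) \<bullet> gradient g (?p t)"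
    by auto
  have "norm (gradient g (?p t) - gradient g y) \<le> M * norm (z - y)"
  proof -
    have "norm (gradient g (?p t) - gradient g y) \<le> M * (t * norm (z - y))"
      using lip[OF pB[OF t]] t by simp
    also have "\<dots> \<le> M * norm (z - y)"
      using t \<open>0 \<le> M\<close> by (intro mult_left_mono mult_left_le_one_le) auto
    finally show ?thesis .
  qed
  then have "norm (z - y) * norm (gradient g (?p t) - gradient g y) \<le> norm (z - y) * (M * norm (z - y))"
    by (intro mult_left_mono) auto
  then have "- (M * (norm (z - y))\<^sup>2) \<le> (z - y) \<bullet> (gradient g (?p t) - gradient g y)"
    using Cauchy_Schwarz_ineq2[of "z - y" "gradient g (?p t) - gradient g y"]
    by (simp add: power2_eq_square algebra_simps)
  then show ?thesis using eq by (simp add: inner_diff_right inner_commute)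
qed

text \<open>The difference of \<open>f\<close> and \<open>g\<close> has a minimum at
  \<open>y\<close>, so its derivative vanishes there.\<close>

lemma gradient_eq_of_touching:
  fixes f g :: "real^'n \<Rightarrow> real"
  assumes "f differentiable (at y)" "g differentiable (at y)" "g y = f y" "\<And>z. g z \<le> f z"
  shows "gradient f y = gradient g y"
proof -
  have "((\<lambda>z. f z - g z) has_derivative (\<lambda>h. h \<bullet> gradient f y - h \<bullet> gradient g y)) (at y)"
    using GDERIV_gradient[OF assms(1)] GDERIV_gradient[OF assms(2)]
    unfolding gderiv_def by (rule has_derivative_diff)
  then have "(\<lambda>h. h \<bullet> gradient f y - h \<bullet> gradient g y) = (\<lambda>h. 0)"
    by (rule has_derivative_local_min) (use assms(3,4) in \<open>auto intro!: always_eventually\<close>)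
  then have "h \<bullet> gradient f y = h \<bullet> gradient g y" for h
    by (meson eq_iff_diff_eq_0)
  then show ?thesis by (metis vector_eq_ldot)
qed

section \<open>Finite covers by closed sets\<close>

lemma interior_Union_closed_empty:
  assumes "finite F" "\<And>S. S \<in> F \<Longrightarrow> closed S \<and> interior S = {}"
  shows "interior (\<Union>F) = {}"
  using assms
proof (induction F rule: finite_induct)
  case empty
  then show ?case by simp
next
  case (insert S F)
  then show ?case
    using interior_closed_Un_empty_interior[of S "\<Union>F"] by simp
qed

text \<open>A finite Baire argument: the complement of the union of these closures is open and
  covered by the sets \<open>A k - interior (A k)\<close>, which are finitely many closed sets with
  empty interior.\<close>

lemma finite_closed_cover_closure_interior:
  fixes A :: "'i \<Rightarrow> 'a::topological_space set"
  assumes "finite I" "\<And>k. k \<in> I \<Longrightarrow> closed (A k)" "(\<Union>k\<in>I. A k) = UNIV"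
  shows "(\<Union>k\<in>I. closure (interior (A k))) = UNIV"
proof -
  let ?U = "- (\<Union>k\<in>I. closure (interior (A k)))"
  have op: "open ?U" using assms(1) by (intro open_Compl closed_UN) auto
  have "interior (\<Union>k\<in>I. A k - interior (A k)) = {}"
  proof (rule interior_Union_closed_empty)
    fix S assume "S \<in> (\<lambda>k. A k - interior (A k)) ` I"
    then obtain k where k: "k \<in> I" "S = A k - interior (A k)" by auto
    have "closed S" using assms(2) k by (auto intro!: closed_Diff)
    moreover have "interior S = {}"
      using k by (metis Diff_disjoint Diff_subset disjoint_iff interior_mono interior_subset subset_iff equals0I)
    ultimately show "closed S \<and> interior S = {}" by blast
  qed (use assms in auto)
  moreover have "?U \<subseteq> (\<Union>k\<in>I. A k - interior (A k))"
  proof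
    fix x assume "x \<in> ?U"
    moreover obtain k where "k \<in> I" "x \<in> A k" using assms(3) by blast
    ultimately show "x \<in> (\<Union>k\<in>I. A k - interior (A k))"
      using closure_subset by blast
  qed
  ultimately have "?U = {}" using op interior_maximal by blast
  then show ?thesis by auto
qed

section \<open>Locally weakly convex functions\<close>

text \<open>The last clause says that \<open>f\<close> plus \<open>M\<close> times the squared norm
  has a supporting affine function at \<open>y\<close> over the ball. For fixed \<open>z\<close>,
  all three bounds are closed conditions on the jet at \<open>y\<close> when \<open>f\<close> is
  continuous, so they survive passage to limiting jets.\<close>

definition jet_bound :: "(real^'n \<Rightarrow> real) \<Rightarrow> real^'n \<Rightarrow> real \<Rightarrow> real \<Rightarrow> bool" where
  "jet_bound f a r M \<longleftrightarrow> (\<forall>y \<in> ball a r - Omega2 f.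
     norm (gradient f y) \<le> M \<and> norm (hessian f y) \<le> M \<and>
     (\<forall>z \<in> ball a r. f y + gradient f y \<bullet> (z - y) - M * (norm (z - y))\<^sup>2 \<le> f z))"

text \<open>The common interface of the convex and the max-type case: the analysis of the algorithm
  sees the structure of \<open>f\<close> only through it. Density allows estimates at arbitrary
  points to be obtained as limits.\<close>

definition locally_weakly_convex :: "(real^'n \<Rightarrow> real) \<Rightarrow> bool" where
  "locally_weakly_convex f \<longleftrightarrow> continuous_on UNIV f \<and> closure (- Omega2 f) = UNIV \<and>
     (\<forall>a. \<exists>r>0. \<exists>M\<ge>0. jet_bound f a r M)"

section \<open>The convex case\<close>

lemma convex_gradient_inequality:
  fixes f :: "real^'n \<Rightarrow> real"
  assumes "convex_on UNIV f" "f differentiable (at y)"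
  shows "f y + gradient f y \<bullet> (z - y) \<le> f z"
proof -
  let ?p = "\<lambda>t. y + t *\<^sub>R (z - y)"
  \<comment> \<open>Restriction to the line through \<open>y\<close> and \<open>z\<close> reduces
    the claim to the tangent inequality in one real variable.\<close>
  have conv: "convex_on UNIV (\<lambda>t. f (?p t))"
  proof (rule convex_onI)
    fix t u v :: real assume t: "0 < t" "t < 1"
    have "?p ((1 - t) *\<^sub>R u + t *\<^sub>R v) = (1 - t) *\<^sub>R ?p u + t *\<^sub>R ?p v"
      by (simp add: algebra_simps)
    then show "f (?p ((1 - t) *\<^sub>R u + t *\<^sub>R v)) \<le> (1 - t) * f (?p u) + t * f (?p v)"
      using convex_onD[OF assms(1), of t "?p u" "?p v"] t by simp
  qed simp
  have "(f has_derivative (\<lambda>h. h \<bullet> gradient f y)) (at (?p 0))"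
    using GDERIV_gradient[OF assms(2)] by (simp add: gderiv_def)
  moreover have "(?p has_derivative (\<lambda>h. h *\<^sub>R (z - y))) (at 0)"
    by (auto intro!: derivative_eq_intros)
  ultimately have "((\<lambda>t. f (?p t)) has_derivative (\<lambda>h. (h *\<^sub>R (z - y)) \<bullet> gradient f y)) (at 0)"
    by (rule has_derivative_compose[rotated])
  then have "((\<lambda>t. f (?p t)) has_field_derivative ((z - y) \<bullet> gradient f y)) (at 0 within UNIV)"
  proof -
    have "(\<lambda>h. (h *\<^sub>R (z - y)) \<bullet> gradient f y) = (*) ((z - y) \<bullet> gradient f y)"
      by (auto simp: mult.commute)
    then show ?thesis
      using \<open>((\<lambda>t. f (?p t)) has_derivative _) (at 0)\<close> by (simp only: has_field_derivative_def)
  qed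
  from convex_on_imp_above_tangent[OF conv _ _ _ this, of 1]
  show ?thesis by (simp add: inner_commute)
qed

lemma locally_weakly_convex_convex:
  fixes f :: "real^'n \<Rightarrow> real"
  assumes conv: "convex_on UNIV f" and lip: "locally_lipschitz f"
    and null: "Omega2 f \<in> null_sets lebesgue"
    and bd: "\<forall>x. \<exists>V. open V \<and> x \<in> V \<and> bounded (hessian f ` (V - Omega2 f))"
  shows "locally_weakly_convex f"
  unfolding locally_weakly_convex_def
proof (intro conjI allI)
  show "continuous_on UNIV f"
    using lip unfolding locally_lipschitz_def
    by (metis UNIV_I continuous_on_eq_continuous_at continuous_at_imp_continuous_on lipschitz_on_continuous_on)
  \<comment> \<open>A nonempty open set is not a null set; this is the density of the
    complement.\<close>
  have "interior (Omega2 f) = {}"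
    using null open_not_negligible[OF open_interior] negligible_subset interior_subset
    by (metis negligible_iff_null_sets)
  then show "closure (- Omega2 f) = UNIV"
    by (simp add: closure_complement)
  fix a
  obtain U L where U: "open U" "a \<in> U" and L: "L-lipschitz_on U f"
    using lip unfolding locally_lipschitz_def by blast
  obtain V where V: "open V" "a \<in> V" "bounded (hessian f ` (V - Omega2 f))"
    using bd by blast
  obtain B where B: "\<And>y. y \<in> V - Omega2 f \<Longrightarrow> norm (hessian f y) \<le> B"
    using V(3) unfolding bounded_iff by auto
  have "open (U \<inter> V)" "a \<in> U \<inter> V" using U V by auto
  then obtain e where e: "e > 0" "ball a e \<subseteq> U \<inter> V"
    by (meson open_contains_ball)
  \<comment> \<open>Half of \<open>e\<close>, so that a step of length \<open>r\<close> from a point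
    of \<open>ball a r\<close> stays in \<open>U\<close>.\<close>
  define r where "r = e / 2"
  have L0: "0 \<le> L" using L lipschitz_on_nonneg by blast
  have "jet_bound f a r (L + \<bar>B\<bar>)"
    unfolding jet_bound_def
  proof (intro ballI conjI)
    fix y assume y: "y \<in> ball a r - Omega2 f"
    then have d: "f differentiable (at y)" by (simp add: differentiable_of_notin_Omega2)
    have yV: "y \<in> U" "y \<in> V" using y e by (auto simp: r_def)
    show "norm (hessian f y) \<le> L + \<bar>B\<bar>" using B[of y] yV y L0 by auto
    show "norm (gradient f y) \<le> L + \<bar>B\<bar>"
    proof (cases "gradient f y = 0")
      case False
      \<comment> \<open>Moving by \<open>r\<close> along the gradient raises \<open>f\<close> by at
        least \<open>r\<close> times the gradient norm, and the Lipschitz bound allows at most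
        \<open>L * r\<close>.\<close>
      define z where "z = y + (r / norm (gradient f y)) *\<^sub>R gradient f y"
      have nz: "norm (z - y) = r" using False e by (simp add: z_def r_def)
      have "dist a z \<le> dist a y + dist y z" by (rule dist_triangle)
      then have "dist a z < e" using y nz by (simp add: r_def dist_norm norm_minus_commute)
      then have "z \<in> U" using e by auto
      have "gradient f y \<bullet> (z - y) = r * norm (gradient f y)"
        using False by (simp add: z_def dot_square_norm power2_eq_square)
      then have "r * norm (gradient f y) \<le> f z - f y"
        using convex_gradient_inequality[OF conv d, of z] by simp
      also have "\<dots> \<le> L * r"
        using lipschitz_onD[OF L \<open>z \<in> U\<close> yV(1)] nz by (simp add: dist_norm)
      finally have "norm (gradient f y) \<le> L" using e by (simp add: r_def mult.commute)
      then show ?thesis by simp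
    qed (use L0 in simp)
    fix z
    have "0 \<le> (L + \<bar>B\<bar>) * (norm (z - y))\<^sup>2" using L0 by simp
    then show "f y + gradient f y \<bullet> (z - y) - (L + \<bar>B\<bar>) * (norm (z - y))\<^sup>2 \<le> f z"
      using convex_gradient_inequality[OF conv d, of z] by linarith
  qed
  moreover have "0 < r" "0 \<le> L + \<bar>B\<bar>" using e L0 by (auto simp: r_def)
  ultimately show "\<exists>r>0. \<exists>M\<ge>0. jet_bound f a r M" by blast
qed

section \<open>The max-type case\<close>

lemma continuous_on_Max_finite:
  fixes g :: "'i \<Rightarrow> 'a::topological_space \<Rightarrow> real"
  assumes "finite I" "I \<noteq> {}" "\<And>k. k \<in> I \<Longrightarrow> continuous_on S (g k)"
  shows "continuous_on S (\<lambda>x. Max ((\<lambda>k. g k x) ` I))"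
  using assms
proof (induction I rule: finite_ne_induct)
  case (insert k I)
  have "(\<lambda>x. Max ((\<lambda>k. g k x) ` insert k I)) = (\<lambda>x. max (g k x) (Max ((\<lambda>k. g k x) ` I)))"
    using insert.hyps by simp
  then show ?case using insert by (simp add: continuous_on_max)
qed simp

text \<open>The closed sets \<open>A k\<close> cover the space, so every point is a limit of
  interior points of some \<open>A k\<close>, where \<open>f\<close> is locally the smooth function
  \<open>g k\<close>. This yields density, and at points outside \<open>Omega2 f\<close> the value,
  gradient and Hessian are those of one such \<open>g k\<close>. The lower bound for
  \<open>g k\<close> passes to \<open>f\<close> because \<open>g k\<close> lies below
  \<open>f\<close>.\<close>

lemma locally_weakly_convex_max_type:
  fixes f :: "real^'n \<Rightarrow> real" and g :: "'i \<Rightarrow> real^'n \<Rightarrow> real"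
  assumes I: "finite I" "I \<noteq> {}" and C3: "\<And>k. k \<in> I \<Longrightarrow> C3 (g k)"
    and f: "\<And>x. f x = Max ((\<lambda>k. g k x) ` I)"
    and C2: "\<And>x. f differentiable (at x) \<Longrightarrow> C2_at f x"
  shows "locally_weakly_convex f"
proof -
  define A where "A k = {x. f x = g k x}" for k
  have td: "twice_differentiable_at (g k) x" if "k \<in> I" for k x
    using C3[OF that] by (simp add: C3_def)
  have diff: "g k differentiable (at x)" if "k \<in> I" for k x
    using td[OF that] by (auto simp: twice_differentiable_at_def dest: eventually_nhds_x_imp_x)
  have cont: "continuous_on UNIV (g k)" if "k \<in> I" for k
    using diff[OF that] by (simp add: continuous_at_imp_continuous_on differentiable_imp_continuous_within)
  have contg: "continuous_on UNIV (gradient (g k))" if "k \<in> I" for k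
    using td[OF that]
    by (simp add: continuous_at_imp_continuous_on differentiable_imp_continuous_within twice_differentiable_at_def)
  have conth: "continuous_on UNIV (hessian (g k))" if "k \<in> I" for k
    using C3[OF that] unfolding C3_def
    by (meson continuous_at_imp_continuous_on has_derivative_continuous)
  have contf: "continuous_on UNIV f"
    using continuous_on_Max_finite[OF I cont] f by (simp add: fun_eq_iff[symmetric] cong: continuous_on_cong)
  have le: "g k x \<le> f x" if "k \<in> I" for k x
    using that I f by simp
  have closed: "closed (A k)" if "k \<in> I" for k
    unfolding A_def by (intro closed_Collect_eq contf cont that)
  have "(\<Union>k\<in>I. A k) = UNIV"
  proof -
    have "\<exists>k\<in>I. x \<in> A k" for x
    proof -
      have "f x \<in> (\<lambda>k. g k x) ` I"
        unfolding f using I by (intro Max_in) auto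
      then show ?thesis by (auto simp: A_def)
    qed
    then show ?thesis by auto
  qed
  from finite_closed_cover_closure_interior[of I A, OF I(1) closed this]
  have cov: "\<exists>k\<in>I. x \<in> closure (interior (A k))" for x
    by auto
  have int: "x \<notin> Omega2 f \<and> hessian f x = hessian (g k) x" if "k \<in> I" "x \<in> interior (A k)" for k x
  proof -
    have "f y = g k y" if "y \<in> interior (A k)" for y
      using that interior_subset[of "A k"] by (auto simp: A_def)
    from twice_differentiable_at_cong[OF open_interior that(2) this td[OF that(1)]]
    show ?thesis by (simp add: Omega2_def)
  qed
  have dense: "closure (- Omega2 f) = UNIV"
  proof -
    have "x \<in> closure (- Omega2 f)" for x
    proof -
      obtain k where k: "k \<in> I" "x \<in> closure (interior (A k))" using cov by blast
      have "interior (A k) \<subseteq> - Omega2 f" using int[OF k(1)] by auto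
      then show ?thesis using closure_mono k(2) by blast
    qed
    then show ?thesis by auto
  qed
  have active: "\<exists>k\<in>I. g k y = f y \<and> gradient f y = gradient (g k) y \<and> hessian f y = hessian (g k) y"
    if y: "y \<notin> Omega2 f" for y
  proof -
    \<comment> \<open>Choosing an index that is active on an open set accumulating at \<open>y\<close>, and not merely active
      at \<open>y\<close>, is what makes the Hessians agree.\<close>
    obtain k where k: "k \<in> I" "y \<in> closure (interior (A k))" using cov by blast
    have "y \<in> A k"
      using closure_minimal[OF interior_subset closed[OF k(1)]] k(2) by blast
    then have eq: "g k y = f y" by (simp add: A_def)
    have df: "f differentiable (at y)" using y by (rule differentiable_of_notin_Omega2)
    obtain U where U: "open U" "y \<in> U" "continuous_on U (hessian f)"
      using C2[OF df] unfolding C2_at_def by blast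
    obtain u where u: "\<And>n. u n \<in> interior (A k)" "u \<longlonglongrightarrow> y"
      using k(2) unfolding closure_sequential by blast
    have "(\<lambda>n. hessian f (u n)) \<longlonglongrightarrow> hessian f y"
      using U u(2) by (metis continuous_on_eq_continuous_at isCont_tendsto_compose)
    moreover have "(\<lambda>n. hessian (g k) (u n)) \<longlonglongrightarrow> hessian (g k) y"
      using conth[OF k(1)] u(2) by (metis UNIV_I continuous_on_eq_continuous_at isCont_tendsto_compose open_UNIV)
    moreover have "(\<lambda>n. hessian f (u n)) = (\<lambda>n. hessian (g k) (u n))"
      using int[OF k(1) u(1)] by auto
    ultimately have "hessian f y = hessian (g k) y"
      using LIMSEQ_unique by metis
    moreover have "gradient f y = gradient (g k) y"
      by (rule gradient_eq_of_touching[OF df diff[OF k(1)] eq le[OF k(1)]])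
    ultimately show ?thesis using k(1) eq by blast
  qed
  have "\<exists>r>0. \<exists>M\<ge>0. jet_bound f a r M" for a
  proof -
    obtain K :: real where K: "K > 0" "\<And>A (v::real^'n). norm ((A::real^'n^'n) *v v) \<le> norm A * norm v * K"
      using matrix_vector_mult_bounded by blast
    have "bounded (\<Union>k\<in>I. gradient (g k) ` cball a 1)"
      using I(1) contg by (intro bounded_UN ballI compact_imp_bounded compact_continuous_image)
        (auto intro: continuous_on_subset)
    then obtain M1 where M1: "\<And>k x. k \<in> I \<Longrightarrow> x \<in> cball a 1 \<Longrightarrow> norm (gradient (g k) x) \<le> M1"
      unfolding bounded_iff by blast
    have "bounded (\<Union>k\<in>I. hessian (g k) ` cball a 1)"
      using I(1) conth by (intro bounded_UN ballI compact_imp_bounded compact_continuous_image)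
        (auto intro: continuous_on_subset)
    then obtain M2 where M2: "\<And>k x. k \<in> I \<Longrightarrow> x \<in> cball a 1 \<Longrightarrow> norm (hessian (g k) x) \<le> M2"
      unfolding bounded_iff by blast
    \<comment> \<open>The summands dominate the gradients, the Hessians, and the Taylor constant, in
      which \<open>K\<close> converts the matrix norm into an operator bound.\<close>
    define M where "M = \<bar>M1\<bar> + \<bar>M2\<bar> + \<bar>M2\<bar> * K"
    have M: "0 \<le> M" "M1 \<le> M" "M2 \<le> M" "\<bar>M2\<bar> * K \<le> M" "0 \<le> \<bar>M2\<bar> * K"
    proof -
      show "0 \<le> \<bar>M2\<bar> * K" using K by simp
      then show "0 \<le> M" "M1 \<le> M" "M2 \<le> M" "\<bar>M2\<bar> * K \<le> M" unfolding M_def by linarith+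
    qed
    have "jet_bound f a 1 M"
      unfolding jet_bound_def
    proof (intro ballI conjI)
      fix y assume y: "y \<in> ball a 1 - Omega2 f"
      then obtain k where k: "k \<in> I" "g k y = f y" "gradient f y = gradient (g k) y"
        "hessian f y = hessian (g k) y" using active by blast
      have yc: "y \<in> cball a 1" using y by auto
      show "norm (gradient f y) \<le> M" "norm (hessian f y) \<le> M"
        using M1[OF k(1) yc] M2[OF k(1) yc] M k by auto
      fix z assume z: "z \<in> ball a 1"
      have "g k y + gradient (g k) y \<bullet> (z - y) - (\<bar>M2\<bar> * K) * (norm (z - y))\<^sup>2 \<le> g k z"
      proof (rule taylor_lower_bound[of "cball a 1"])
        show "norm (hessian (g k) x *v v) \<le> \<bar>M2\<bar> * K * norm v" if "x \<in> cball a 1" for x v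
        proof -
          have "norm (hessian (g k) x *v v) \<le> norm (hessian (g k) x) * (norm v * K)"
            using K(2)[of "hessian (g k) x" v] by simp
          also have "\<dots> \<le> \<bar>M2\<bar> * (norm v * K)"
            using M2[OF k(1) that] K(1) by (intro mult_right_mono) auto
          finally show ?thesis by (simp add: ac_simps)
        qed
      qed (use td k yc z M in auto)
      moreover have "(\<bar>M2\<bar> * K) * (norm (z - y))\<^sup>2 \<le> M * (norm (z - y))\<^sup>2"
        using M by (intro mult_right_mono) auto
      ultimately show "f y + gradient f y \<bullet> (z - y) - M * (norm (z - y))\<^sup>2 \<le> f z"
        using k le[OF k(1), of z] by simp
    qed
    then show ?thesis using M(1) zero_less_one by blast
  qed
  then show ?thesis using contf dense by (simp add: locally_weakly_convex_def)
qed

section \<open>Jets and the sampling scheme\<close>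

text \<open>A jet at \<open>x\<close> is a limit of jets at nearby points outside
  \<open>Omega2 f\<close>, and the closed conditions collected in \<open>P\<close> hold at those
  points.\<close>

lemma jet2_0_bounds:
  fixes f :: "real^'n \<Rightarrow> real"
  assumes jb: "jet_bound f a r M" and cont: "continuous_on UNIV f"
    and x: "x \<in> ball a r" and J: "J \<in> jet2 0 f x"
  obtains \<xi> H where "J = (x, f x, \<xi>, H)" "norm \<xi> \<le> M" "norm H \<le> M"
    "\<And>z. z \<in> ball a r \<Longrightarrow> f x + \<xi> \<bullet> (z - x) - M * (norm (z - x))\<^sup>2 \<le> f z"
proof -
  define P :: "'n jet set" where "P = {J. fst (snd J) = f (fst J)} \<inter>
    {J. norm (fst (snd (snd J))) \<le> M} \<inter> {J. norm (snd (snd (snd J))) \<le> M} \<inter>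
    (\<Inter>z\<in>ball a r. {J. fst (snd J) + fst (snd (snd J)) \<bullet> (z - fst J) - M * (norm (z - fst J))\<^sup>2 \<le> f z})"
  have "closed P"
    unfolding P_def
    by (intro closed_Int closed_INT ballI closed_Collect_eq closed_Collect_le continuous_intros
        continuous_on_compose2[OF cont]) auto
  obtain e where e: "e > 0" "cball x e \<subseteq> ball a r"
    using x open_contains_cball by blast
  have JP: "J \<in> P \<and> fst J \<in> cball x d" if d: "0 < d" "d \<le> e" for d
  proof -
    have "J \<in> closure ((\<lambda>y. (y, f y, gradient f y, hessian f y)) ` (cball x d - Omega2 f))"
      using J d(1) unfolding jet2_def by auto
    moreover have "(\<lambda>y. (y, f y, gradient f y, hessian f y)) ` (cball x d - Omega2 f) \<subseteq> P \<inter> {J. fst J \<in> cball x d}"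
    proof -
      have "y \<in> ball a r" if "y \<in> cball x d" for y
        using that d e by (meson cball_subset_cball_iff order_trans subset_cball subsetD)
      then show ?thesis using jb unfolding P_def jet_bound_def by auto
    qed
    moreover have "closed (P \<inter> {J. fst J \<in> cball x d})"
    proof -
      have "closed {J :: 'n jet. dist x (fst J) \<le> d}"
        by (intro closed_Collect_le continuous_intros)
      then show ?thesis using \<open>closed P\<close> by (simp add: closed_Int)
    qed
    ultimately show ?thesis using closure_minimal by blast
  qed
  \<comment> \<open>For \<open>\<epsilon> = 0\<close> the intersection runs over all positive radii,
    which pins the base point to \<open>x\<close>.\<close>
  have "dist x (fst J) \<le> 0"
  proof (rule dense_ge)
    fix d :: real assume "0 < d"
    then show "dist x (fst J) \<le> d" using JP[of "min d e"] e(1) by auto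
  qed
  then have "fst J = x" by simp
  then show thesis
    using JP[of e] e(1) that[of "fst (snd (snd J))" "snd (snd (snd J))"]
    by (cases J) (auto simp: P_def)
qed

section \<open>Model bounds and termination of sampling\<close>

lemma model_le_iff:
  assumes "finite W" "W \<noteq> {}"
  shows "model W z \<le> b \<longleftrightarrow>
    (\<forall>(y, v, \<xi>, H) \<in> W. v + \<xi> \<bullet> (z - y) + 1/2 * ((z - y) \<bullet> (H *v (z - y))) \<le> b)"
  unfolding model_def using assms by (subst Max_le_iff) auto

lemma model_ge:
  assumes "finite W" "(y, v, \<xi>, H) \<in> W"
  shows "v + \<xi> \<bullet> (z - y) + 1/2 * ((z - y) \<bullet> (H *v (z - y))) \<le> model W z"
  unfolding model_def using assms by (intro Max_ge) (auto intro: rev_image_eqI)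

text \<open>The initial jet is based at the center and every later one at a minimizer in the trust
  region. The restriction to \<open>enat k \<le> m\<close> matters, since \<open>W\<close> is
  arbitrary after the last pass.\<close>

lemma sampling_jets:
  assumes ex: "sampling_execution f x c \<epsilon> \<tau> W z m" and "0 \<le> \<epsilon>" "enat k \<le> m"
  shows "finite (W k) \<and> W k \<noteq> {} \<and> W k \<subseteq> (\<Union>y\<in>cball x \<epsilon>. jet2 0 f y)"
  using assms(3)
proof (induction k)
  case 0
  then show ?case using ex assms(2) unfolding sampling_execution_def by force
next
  case (Suc k)
  then have lt: "enat k < m" and "enat k \<le> m" by (auto simp: Suc_ile_eq less_imp_le)
  have IH: "finite (W k) \<and> W k \<noteq> {} \<and> W k \<subseteq> (\<Union>y\<in>cball x \<epsilon>. jet2 0 f y)"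
    using Suc.IH lt by (simp add: less_imp_le)
  have "z k \<in> cball x \<epsilon>"
    using ex lt unfolding sampling_execution_def model_minimizer_def is_arg_min_def
    by (meson less_imp_le)
  moreover obtain J where "J \<in> jet2 0 f (z k)" "W (Suc k) = W k \<union> {J}"
    using ex lt unfolding sampling_execution_def by blast
  ultimately show ?case using IH by auto
qed

text \<open>Each piece of the model is a linearization, which weak convexity keeps below
  \<open>f\<close> up to a quadratic error, plus a quadratic term controlled by the Hessian bound.
  The constants depend on \<open>a\<close> alone, hence are uniform over centers, radii and jet
  sets.\<close>

lemma model_upper_bound:
  fixes f :: "real^'n \<Rightarrow> real"
  assumes f: "locally_weakly_convex f"
  obtains r C where "0 < r" "0 \<le> C"
    "\<And>x \<epsilon> W z. \<lbrakk>dist a x < r; 0 \<le> \<epsilon>; \<epsilon> < r; finite W; W \<noteq> {}; W \<subseteq> (\<Union>y\<in>cball x \<epsilon>. jet2 0 f y);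
       z \<in> cball x \<epsilon>\<rbrakk> \<Longrightarrow> model W z \<le> f z + C * \<epsilon>\<^sup>2"
proof -
  have cont: "continuous_on UNIV f" using f by (simp add: locally_weakly_convex_def)
  obtain r M where r: "r > 0" "M \<ge> 0" and jb: "jet_bound f a r M"
    using f unfolding locally_weakly_convex_def by blast
  obtain K :: real where K: "K > 0" "\<And>A (v::real^'n). norm ((A::real^'n^'n) *v v) \<le> norm A * norm v * K"
    using matrix_vector_mult_bounded by blast
  \<comment> \<open>Halving \<open>r\<close> keeps the whole trust region inside
    \<open>ball a r\<close>. Two of its points are at most \<open>2 * \<epsilon>\<close> apart,
    hence the factor 4; \<open>M\<close> comes from weak convexity and \<open>M * K\<close> from the
    quadratic term.\<close>
  show thesis
  proof (rule that[of "r/2" "4 * (M + M * K)"])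
    fix x \<epsilon> W z
    assume x: "dist a x < r/2" and e: "0 \<le> \<epsilon>" "\<epsilon> < r/2" and W: "finite W" "W \<noteq> {}"
      "W \<subseteq> (\<Union>y\<in>cball x \<epsilon>. jet2 0 f y)" and z: "z \<in> cball x \<epsilon>"
    have inb: "w \<in> ball a r" if "w \<in> cball x \<epsilon>" for w
      using dist_triangle[of a w x] that x e by simp
    show "model W z \<le> f z + 4 * (M + M * K) * \<epsilon>\<^sup>2"
      unfolding model_le_iff[OF W(1,2)]
    proof (clarify)
      fix y' v \<xi>' H' assume "(y', v, \<xi>', H') \<in> W"
      then obtain y where y: "y \<in> cball x \<epsilon>" and J: "(y', v, \<xi>', H') \<in> jet2 0 f y" using W(3) by blast
      obtain \<xi> H where eq: "(y', v, \<xi>', H') = (y, f y, \<xi>, H)" and H: "norm H \<le> M"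
        and lb: "\<And>z. z \<in> ball a r \<Longrightarrow> f y + \<xi> \<bullet> (z - y) - M * (norm (z - y))\<^sup>2 \<le> f z"
        using jet2_0_bounds[OF jb cont inb[OF y] J] by metis
      have d: "norm (z - y) \<le> 2 * \<epsilon>"
        using dist_triangle[of z y x] y z by (simp add: dist_commute flip: dist_norm)
      have d2: "(norm (z - y))\<^sup>2 \<le> 4 * \<epsilon>\<^sup>2"
        using power_mono[OF d norm_ge_zero, of 2] by (simp add: power_mult_distrib)
      have "(z - y) \<bullet> (H *v (z - y)) \<le> norm (z - y) * norm (H *v (z - y))"
        by (rule norm_cauchy_schwarz)
      also have "\<dots> \<le> norm (z - y) * (norm H * norm (z - y) * K)"
        using K by (intro mult_left_mono) auto
      also have "\<dots> \<le> norm (z - y) * (M * norm (z - y) * K)"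
        using K H by (intro mult_left_mono mult_right_mono) auto
      also have "\<dots> = (M * K) * (norm (z - y))\<^sup>2" by (simp add: power2_eq_square)
      also have "\<dots> \<le> (M * K) * (4 * \<epsilon>\<^sup>2)" using d2 K r by (intro mult_left_mono) auto
      finally have q: "(z - y) \<bullet> (H *v (z - y)) \<le> (M * K) * (4 * \<epsilon>\<^sup>2)" .
      have "0 \<le> (M * K) * (4 * \<epsilon>\<^sup>2)" using K r by simp
      moreover have "M * (norm (z - y))\<^sup>2 \<le> M * (4 * \<epsilon>\<^sup>2)" using d2 r by (intro mult_left_mono)
      ultimately show "v + \<xi>' \<bullet> (z - y') + 1/2 * ((z - y') \<bullet> (H' *v (z - y'))) \<le> f z + 4 * (M + M * K) * \<epsilon>\<^sup>2"
        using lb[OF inb[OF z]] q eq by (simp add: algebra_simps)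
    qed
  qed (use r K in auto)
qed

text \<open>The returned \<open>\<theta>\<close> is the minimum of the model over the ball, so the
  upper bound on the model at each \<open>z\<close> becomes a lower bound on
  \<open>f z\<close>.\<close>

lemma sampling_returns_lower_bound:
  fixes f :: "real^'n \<Rightarrow> real"
  assumes f: "locally_weakly_convex f"
  obtains r C where "0 < r" "0 \<le> C"
    "\<And>x c \<epsilon> \<tau> \<theta> w z. \<lbrakk>dist a x < r; 0 \<le> \<epsilon>; \<epsilon> < r; sampling_returns f x c \<epsilon> \<tau> \<theta> w; z \<in> cball x \<epsilon>\<rbrakk>
       \<Longrightarrow> \<theta> \<le> f z + C * \<epsilon>\<^sup>2"
proof -
  obtain r C where r: "0 < r" "0 \<le> C" and
    b: "\<And>x \<epsilon> W z. \<lbrakk>dist a x < r; 0 \<le> \<epsilon>; \<epsilon> < r; finite W; W \<noteq> {}; W \<subseteq> (\<Union>y\<in>cball x \<epsilon>. jet2 0 f y);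
       z \<in> cball x \<epsilon>\<rbrakk> \<Longrightarrow> model W z \<le> f z + C * \<epsilon>\<^sup>2"
    using model_upper_bound[OF f, of a] by blast
  show thesis
  proof (rule that[OF r])
    fix x c \<epsilon> \<tau> \<theta> w z
    assume a: "dist a x < r" "0 \<le> \<epsilon>" "\<epsilon> < r" "sampling_returns f x c \<epsilon> \<tau> \<theta> w" "z \<in> cball x \<epsilon>"
    then obtain W u k where ex: "sampling_execution f x c \<epsilon> \<tau> W u (enat k)" and th: "\<theta> = model (W k) (u k)"
      unfolding sampling_returns_def by blast
    have "model_minimizer (W k) x \<epsilon> (u k)" using ex unfolding sampling_execution_def by blast
    then have "model (W k) (u k) \<le> model (W k) z"
      using a(5) unfolding model_minimizer_def is_arg_min_linorder by blast
    also have "\<dots> \<le> f z + C * \<epsilon>\<^sup>2"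
      using sampling_jets[OF ex a(2), of k] by (intro b[OF a(1-3) _ _ _ a(5)]) auto
    finally show "\<theta> \<le> f z + C * \<epsilon>\<^sup>2" using th by simp
  qed
qed

lemma sampling_terminates:
  fixes f :: "real^'n \<Rightarrow> real"
  assumes f: "locally_weakly_convex f" and pos: "0 < \<epsilon>" "0 < \<tau>" and c: "c < 1"
  shows "\<not> sampling_diverges f x c \<epsilon> \<tau>"
proof
  assume "sampling_diverges f x c \<epsilon> \<tau>"
  then obtain W z where ex: "sampling_execution f x c \<epsilon> \<tau> W z \<infinity>"
    unfolding sampling_diverges_def by blast
  have cont: "continuous_on UNIV f" using f by (simp add: locally_weakly_convex_def)
  define \<theta> where "\<theta> k = model (W k) (z k)" for k
  have mini: "model_minimizer (W k) x \<epsilon> (z k)" for k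
    using ex unfolding sampling_execution_def by simp
  have nstop: "\<not> sampling_stop f x c \<epsilon> \<tau> (W k) (z k)" for k
    using ex unfolding sampling_execution_def by (simp only: enat_ord_simps) blast
  have next_jet: "\<exists>J\<in>jet2 0 f (z k). W (Suc k) = W k \<union> {J}" for k
    using ex unfolding sampling_execution_def by (simp only: enat_ord_simps) blast
  obtain J where J: "\<And>k. J k \<in> jet2 0 f (z k)" "\<And>k. W (Suc k) = W k \<union> {J k}"
    using next_jet by metis
  have fin: "finite (W k)" "W k \<noteq> {}" for k
    using sampling_jets[OF ex, of k] pos by auto
  have zc: "z k \<in> cball x \<epsilon>" and min: "w \<in> cball x \<epsilon> \<Longrightarrow> \<theta> k \<le> model (W k) w" for k w
    using mini[of k] unfolding model_minimizer_def is_arg_min_linorder \<theta>_def by auto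
  have up: "\<theta> k \<le> f x - \<tau> * \<epsilon>" and lo: "c * \<theta> k + (1 - c) * f x < f (z k)" for k
    using nstop[of k] pos unfolding sampling_stop_def \<theta>_def by (auto simp: field_simps)
  \<comment> \<open>Adding jets only raises the model pointwise, so its minimum over the fixed ball
    rises too.\<close>
  have "incseq \<theta>"
  proof (rule incseq_SucI)
    fix k
    have "\<theta> k \<le> model (W k) (z (Suc k))" using min zc by blast
    also have "\<dots> \<le> model (W (Suc k)) (z (Suc k))"
      unfolding model_def by (intro Max_mono image_mono finite_imageI fin) (auto simp: fin J(2))
    finally show "\<theta> k \<le> \<theta> (Suc k)" by (simp add: \<theta>_def)
  qed
  then obtain t where t: "\<theta> \<longlonglongrightarrow> t"
    using incseq_convergent[of \<theta>] up by blast
  obtain a p where p: "strict_mono p" and a: "(z \<circ> p) \<longlonglongrightarrow> a"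
    using zc compact_cball[of x \<epsilon>] unfolding compact_def by metis
  obtain r M where r: "r > 0" "M \<ge> 0" and jb: "jet_bound f a r M"
    using f unfolding locally_weakly_convex_def by blast
  obtain K :: real where K: "K > 0" "\<And>A (v::real^'n). norm ((A::real^'n^'n) *v v) \<le> norm A * norm v * K"
    using matrix_vector_mult_bounded by blast
  \<comment> \<open>Jets are never discarded: the jet taken at \<open>z (p n)\<close> enters after
    pass \<open>p n\<close> and is still present in pass \<open>p (Suc n)\<close>. There it is
    evaluated at distance \<open>d n\<close> from its base point, which tends to 0.\<close>
  have Jin: "J k \<in> W k'" if "k < k'" for k k'
    using that by (induction k') (auto simp: J(2) less_Suc_eq)
  have tp: "(\<lambda>n. \<theta> (p n)) \<longlonglongrightarrow> t"
    using LIMSEQ_subseq_LIMSEQ[OF t p] by (simp add: o_def)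
  define d where "d n = norm (z (p (Suc n)) - z (p n))" for n
  have a': "(\<lambda>n. z (p n)) \<longlonglongrightarrow> a" using a by (simp add: o_def)
  have fz: "(\<lambda>n. f (z (p n))) \<longlonglongrightarrow> f a"
    using continuous_on_tendsto_compose[OF cont a'] by simp
  have d0: "d \<longlonglongrightarrow> 0"
    using tendsto_norm[OF tendsto_diff[OF LIMSEQ_Suc[OF a'] a']] by (simp add: d_def[abs_def])
  have "\<forall>\<^sub>F n in sequentially. z (p n) \<in> ball a r"
    using r(1) by (intro topological_tendstoD[OF a']) auto
  then have "\<forall>\<^sub>F n in sequentially. f (z (p n)) - M * d n - 1/2 * (M * K * (d n)\<^sup>2) \<le> \<theta> (p (Suc n))"
  proof eventually_elim
    fix n assume n: "z (p n) \<in> ball a r"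
    obtain \<xi> H where eq: "J (p n) = (z (p n), f (z (p n)), \<xi>, H)" and b: "norm \<xi> \<le> M" "norm H \<le> M"
      using jet2_0_bounds[OF jb cont n J(1)] by metis
    let ?v = "z (p (Suc n)) - z (p n)"
    have "J (p n) \<in> W (p (Suc n))" using Jin p by (simp add: strict_mono_Suc_iff)
    then have ge: "f (z (p n)) + \<xi> \<bullet> ?v + 1/2 * (?v \<bullet> (H *v ?v)) \<le> \<theta> (p (Suc n))"
      unfolding \<theta>_def eq by (rule model_ge[OF fin(1)])
    have "\<bar>\<xi> \<bullet> ?v\<bar> \<le> norm \<xi> * d n" unfolding d_def by (rule Cauchy_Schwarz_ineq2)
    also have "\<dots> \<le> M * d n" using b by (intro mult_right_mono) (auto simp: d_def)
    finally have 1: "- (M * d n) \<le> \<xi> \<bullet> ?v" by linarith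
    have "\<bar>?v \<bullet> (H *v ?v)\<bar> \<le> d n * norm (H *v ?v)" unfolding d_def by (rule Cauchy_Schwarz_ineq2)
    also have "\<dots> \<le> d n * (norm H * d n * K)"
      using K(2)[of H ?v] by (intro mult_left_mono) (auto simp: d_def)
    also have "\<dots> \<le> d n * (M * d n * K)"
      using K b by (intro mult_left_mono mult_right_mono) (auto simp: d_def)
    also have "\<dots> = M * K * (d n)\<^sup>2" by (simp add: power2_eq_square)
    finally have 2: "- (M * K * (d n)\<^sup>2) \<le> ?v \<bullet> (H *v ?v)" by linarith
    show "f (z (p n)) - M * d n - 1/2 * (M * K * (d n)\<^sup>2) \<le> \<theta> (p (Suc n))"
      using ge 1 2 by linarith
  qed
  moreover have "(\<lambda>n. f (z (p n)) - M * d n - 1/2 * (M * K * (d n)\<^sup>2)) \<longlonglongrightarrow> f a - M * 0 - 1/2 * (M * K * 0\<^sup>2)"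
    by (intro tendsto_intros fz d0)
  ultimately have "f a - M * 0 - 1/2 * (M * K * 0\<^sup>2) \<le> t"
    using tendsto_le[OF sequentially_bot LIMSEQ_Suc[OF tp]] by blast
  then have 1: "f a \<le> t" by simp
  have "(\<lambda>n. c * \<theta> (p n) + (1 - c) * f x) \<longlonglongrightarrow> c * t + (1 - c) * f x"
    by (intro tendsto_intros tp)
  then have 2: "c * t + (1 - c) * f x \<le> f a"
    by (rule LIMSEQ_le[OF _ fz]) (use less_imp_le[OF lo] in blast)
  have 3: "t \<le> f x - \<tau> * \<epsilon>"
    by (rule LIMSEQ_le_const2[OF t]) (use up in blast)
  \<comment> \<open>The two bounds enclose \<open>f a\<close> between
    \<open>c * t + (1 - c) * f x\<close> and \<open>t\<close>, which is impossible when
    \<open>t < f x\<close>.\<close>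
  have "(1 - c) * f x \<le> (1 - c) * t" using 1 2 by (simp add: algebra_simps)
  then have "f x \<le> t" using c by simp
  moreover have "0 < \<tau> * \<epsilon>" using pos by simp
  ultimately show False using 3 by simp
qed

section \<open>Criticality of limits of approximate minimizers\<close>

text \<open>Strict separation of 0 from the hull of limiting gradients gives the direction;
  compactness then extends the strict inequality to all gradients at nearby points outside
  \<open>Omega2 f\<close>.\<close>

lemma not_critical_descent_direction:
  fixes f :: "real^'n \<Rightarrow> real"
  assumes f: "locally_weakly_convex f" and nc: "\<not> critical_point f a"
  obtains u b \<delta> where "norm u = 1" "0 < b" "0 < \<delta>"
    "\<And>y. y \<in> ball a \<delta> - Omega2 f \<Longrightarrow> b < u \<bullet> gradient f y"
proof -
  obtain r M where r: "r > 0" "M \<ge> 0" and jb: "jet_bound f a r M"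
    using f unfolding locally_weakly_convex_def by blast
  define G where "G \<delta> = gradient f ` (ball a \<delta> - Omega2 f)" for \<delta>
  \<comment> \<open>\<open>T\<close> consists of the limits of gradients along points outside
    \<open>Omega2 f\<close>. It lies in the set generating the Clarke subdifferential, so its hull
    misses 0 as well, and \<open>jet_bound\<close> makes it compact, as strict separation
    requires.\<close>
  define T where "T = (\<Inter>\<delta>\<in>{0<..}. closure (G \<delta>))"
  have GM: "G r \<subseteq> cball 0 M" using jb unfolding G_def jet_bound_def by auto
  have TS: "T \<subseteq> {\<xi>. \<exists>y :: nat \<Rightarrow> real^'n. (\<forall>i. y i \<notin> Omega f) \<and> y \<longlonglongrightarrow> a \<and> (\<lambda>i. gradient f (y i)) \<longlonglongrightarrow> \<xi>}"
  proof
    fix \<xi> assume \<xi>: "\<xi> \<in> T"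
    have "\<exists>y. y \<in> ball a (1 / real (Suc n)) - Omega2 f \<and> dist (gradient f y) \<xi> < 1 / real (Suc n)" for n
    proof -
      have "\<xi> \<in> closure (G (1 / real (Suc n)))" using \<xi> unfolding T_def by auto
      then have "\<exists>g\<in>G (1 / real (Suc n)). dist g \<xi> < 1 / real (Suc n)"
        unfolding closure_approachable by simp
      then show ?thesis unfolding G_def by blast
    qed
    then obtain y where y: "\<And>n. y n \<in> ball a (1 / real (Suc n)) - Omega2 f"
      "\<And>n. dist (gradient f (y n)) \<xi> < 1 / real (Suc n)" by metis
    have inv: "(\<lambda>n. 1 / real (Suc n)) \<longlonglongrightarrow> 0"
      using LIMSEQ_inverse_real_of_nat by (simp add: inverse_eq_divide)
    have "y \<longlonglongrightarrow> a"
      by (rule metric_tendsto_imp_tendsto[OF inv]) (use y(1) in \<open>auto intro!: always_eventually less_imp_le simp: dist_commute\<close>)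
    moreover have "(\<lambda>n. gradient f (y n)) \<longlonglongrightarrow> \<xi>"
      by (rule metric_tendsto_imp_tendsto[OF inv]) (use y(2) in \<open>auto intro!: always_eventually less_imp_le\<close>)
    moreover have "y n \<notin> Omega f" for n
      using y(1)[of n] differentiable_of_notin_Omega2 by (auto simp: Omega_def)
    ultimately show "\<xi> \<in> {\<xi>. \<exists>y :: nat \<Rightarrow> real^'n. (\<forall>i. y i \<notin> Omega f) \<and> y \<longlonglongrightarrow> a \<and> (\<lambda>i. gradient f (y i)) \<longlonglongrightarrow> \<xi>}"
      by blast
  qed
  have "closed T" unfolding T_def by auto
  moreover have "T \<subseteq> cball 0 M"
  proof -
    have "T \<subseteq> closure (G r)" using r unfolding T_def by auto
    also have "\<dots> \<subseteq> cball 0 M" using GM by (simp add: closure_minimal)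
    finally show ?thesis .
  qed
  ultimately have "compact T"
    by (meson bounded_cball bounded_subset compact_eq_bounded_closed)
  then have "closed (convex hull T)" by (simp add: compact_convex_hull compact_imp_closed)
  moreover have "0 \<notin> convex hull T"
    using nc hull_mono[OF TS, of convex] unfolding critical_point_def clarke_subdifferential_def by blast
  ultimately obtain v \<beta> where v: "v \<noteq> 0" "0 < \<beta>" "\<And>\<xi>. \<xi> \<in> convex hull T \<Longrightarrow> v \<bullet> \<xi> > \<beta>"
    using separating_hyperplane_closed_0[OF convex_convex_hull] by blast
  have "\<exists>\<delta>>0. \<forall>y \<in> ball a \<delta> - Omega2 f. \<beta> < v \<bullet> gradient f y"
  proof (rule ccontr)
    assume "\<not> ?thesis"
    then have no: "\<not> (\<forall>y \<in> ball a \<delta> - Omega2 f. \<beta> < v \<bullet> gradient f y)" if "\<delta> > 0" for \<delta>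
      using that by blast
    have "\<exists>y. y \<in> ball a (1 / real (Suc n)) - Omega2 f \<and> v \<bullet> gradient f y \<le> \<beta>" for n
      using no[of "1 / real (Suc n)"] by (auto simp: not_less)
    then have "\<exists>y. \<forall>n. y n \<in> ball a (1 / real (Suc n)) - Omega2 f \<and> v \<bullet> gradient f (y n) \<le> \<beta>"
      by (intro choice allI)
    then obtain y where "\<forall>n. y n \<in> ball a (1 / real (Suc n)) - Omega2 f \<and> v \<bullet> gradient f (y n) \<le> \<beta>"
      by (rule exE)
    then have y: "\<And>n. y n \<in> ball a (1 / real (Suc n)) - Omega2 f"
      "\<And>n. v \<bullet> gradient f (y n) \<le> \<beta>" by simp_all
    have sm: "\<exists>N. \<forall>n\<ge>N. gradient f (y n) \<in> G \<delta>" if "\<delta> > 0" for \<delta>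
    proof -
      obtain N where N: "1 / real (Suc N) < \<delta>" by (rule nat_approx_posE[OF \<open>0 < \<delta>\<close>])
      have "gradient f (y n) \<in> G \<delta>" if "n \<ge> N" for n
      proof -
        have "1 / real (Suc n) \<le> 1 / real (Suc N)" using that by (simp add: frac_le)
        then show ?thesis using y(1)[of n] N unfolding G_def by auto
      qed
      then show ?thesis by blast
    qed
    obtain N where N: "\<And>n. n \<ge> N \<Longrightarrow> gradient f (y n) \<in> G r" using sm[OF r(1)] by blast
    \<comment> \<open>The shift by \<open>N\<close> discards the initial points, at which no
      gradient bound is available. A limit of the remaining gradients lies in \<open>T\<close> and
      violates the separation.\<close>
    have "\<forall>n. gradient f (y (n + N)) \<in> cball 0 M" using N GM by (meson le_add2 subsetD)
    then obtain \<xi> p where p: "strict_mono p" and \<xi>: "((\<lambda>n. gradient f (y (n + N))) \<circ> p) \<longlonglongrightarrow> \<xi>"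
      using compact_cball[of "0 :: real^'n" M] unfolding compact_def by metis
    have "\<xi> \<in> T" unfolding T_def
    proof
      fix \<delta> :: real assume "\<delta> \<in> {0<..}"
      then obtain N' where N': "\<And>n. n \<ge> N' \<Longrightarrow> gradient f (y n) \<in> G \<delta>" using sm by auto
      have "gradient f (y (p n + N)) \<in> closure (G \<delta>)" if "n \<ge> N'" for n
      proof -
        have "N' \<le> p n + N" using that seq_suble[OF p, of n] by linarith
        then show ?thesis using N' closure_subset by blast
      qed
      then have "\<forall>\<^sub>F n in sequentially. ((\<lambda>n. gradient f (y (n + N))) \<circ> p) n \<in> closure (G \<delta>)"
        unfolding eventually_sequentially by auto
      then show "\<xi> \<in> closure (G \<delta>)"
        using Lim_in_closed_set[OF closed_closure _ sequentially_bot \<xi>] by blast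
    qed
    then have "\<beta> < v \<bullet> \<xi>" by (intro v(3) hull_inc)
    moreover have "v \<bullet> \<xi> \<le> \<beta>"
      by (rule LIMSEQ_le_const2[OF tendsto_inner[OF tendsto_const \<xi>]]) (use y(2) in auto)
    ultimately show False by simp
  qed
  then obtain \<delta> where \<delta>: "\<delta> > 0" "\<And>y. y \<in> ball a \<delta> - Omega2 f \<Longrightarrow> \<beta> < v \<bullet> gradient f y" by blast
  show thesis
  proof (rule that[of "v /\<^sub>R norm v" "\<beta> / norm v" \<delta>])
    fix y assume "y \<in> ball a \<delta> - Omega2 f"
    from \<delta>(2)[OF this] show "\<beta> / norm v < (v /\<^sub>R norm v) \<bullet> gradient f y"
      using v(1) by (simp add: field_simps)
  qed (use v \<delta> in auto)
qed

text \<open>At a noncritical limit, a step of length \<open>e n\<close> along \<open>- u\<close>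
  lowers \<open>f\<close> by at least \<open>b * e n\<close> up to a quadratic error. The assumed
  lower bound allows only a decrease of smaller order than \<open>e n\<close>, so dividing by
  \<open>e n\<close> forces \<open>b \<le> 0\<close>.\<close>

lemma critical_point_of_approximate_minimizers:
  fixes f :: "real^'n \<Rightarrow> real"
  assumes f: "locally_weakly_convex f"
    and x: "x \<longlonglongrightarrow> a" and e: "e \<longlonglongrightarrow> 0" "\<forall>\<^sub>F n in sequentially. 0 < e n" and t: "t \<longlonglongrightarrow> 0"
    and lb: "\<forall>\<^sub>F n in sequentially. \<forall>z \<in> cball (x n) (e n). f (x n) - t n * e n - C * (e n)\<^sup>2 \<le> f z"
  shows "critical_point f a"
proof (rule ccontr)
  assume "\<not> critical_point f a"
  then obtain u b \<delta> where u: "norm u = 1" "0 < b" "0 < \<delta>"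
    and dd: "\<And>y. y \<in> ball a \<delta> - Omega2 f \<Longrightarrow> b < u \<bullet> gradient f y"
    using not_critical_descent_direction[OF f] by blast
  have cont: "continuous_on UNIV f" and dense: "closure (- Omega2 f) = UNIV"
    using f by (auto simp: locally_weakly_convex_def)
  obtain r M where r: "r > 0" "M \<ge> 0" and jb: "jet_bound f a r M"
    using f unfolding locally_weakly_convex_def by blast
  \<comment> \<open>\<open>f\<close> need not be differentiable at \<open>x' - h *\<^sub>R u\<close>, so the weak convexity inequality is
    applied at nearby points outside \<^term>\<open>Omega2 f\<close>.\<close>
  have decr: "f (x' - h *\<^sub>R u) + h * b - M * h\<^sup>2 \<le> f x'"
    if h: "0 \<le> h" and xa: "x' \<in> ball a r" and w: "x' - h *\<^sub>R u \<in> ball a (min r \<delta>)" for x' h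
  proof -
    define w where "w = x' - h *\<^sub>R u"
    obtain y where y: "\<And>n. y n \<notin> Omega2 f" "y \<longlonglongrightarrow> w"
      using dense closure_sequential[of w "- Omega2 f"] by auto
    have "\<forall>\<^sub>F n in sequentially. y n \<in> ball a (min r \<delta>)"
      using y(2) w unfolding w_def by (intro topological_tendstoD) auto
    \<comment> \<open>Splitting \<open>x' - y n\<close> into \<open>h *\<^sub>R u\<close> and
      \<open>w - y n\<close> isolates the gain \<open>h * b\<close>; the second part costs
      \<open>M * norm (w - y n)\<close>, which vanishes in the limit.\<close>
    then have "\<forall>\<^sub>F n in sequentially. f (y n) + h * b - M * norm (w - y n) - M * (norm (x' - y n))\<^sup>2 \<le> f x'"
    proof eventually_elim
      fix n assume n: "y n \<in> ball a (min r \<delta>)"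
      then have yn: "y n \<in> ball a r - Omega2 f" "y n \<in> ball a \<delta> - Omega2 f" using y(1) by auto
      have 1: "f (y n) + gradient f (y n) \<bullet> (x' - y n) - M * (norm (x' - y n))\<^sup>2 \<le> f x'"
        and gM: "norm (gradient f (y n)) \<le> M"
        using jb yn(1) xa unfolding jet_bound_def by auto
      have eq: "x' - y n = h *\<^sub>R u + (w - y n)" by (simp add: w_def)
      have "gradient f (y n) \<bullet> (x' - y n) = h * (u \<bullet> gradient f (y n)) + gradient f (y n) \<bullet> (w - y n)"
        unfolding eq inner_add_right by (simp add: inner_commute)
      moreover have "h * b \<le> h * (u \<bullet> gradient f (y n))"
        using dd[OF yn(2)] h by (intro mult_left_mono) auto
      moreover have "\<bar>gradient f (y n) \<bullet> (w - y n)\<bar> \<le> M * norm (w - y n)"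
        using Cauchy_Schwarz_ineq2[of "gradient f (y n)" "w - y n"] mult_right_mono[OF gM norm_ge_zero[of "w - y n"]]
        by linarith
      ultimately show "f (y n) + h * b - M * norm (w - y n) - M * (norm (x' - y n))\<^sup>2 \<le> f x'"
        using 1 by linarith
    qed
    moreover have "(\<lambda>n. f (y n)) \<longlonglongrightarrow> f w"
      using continuous_on_tendsto_compose[OF cont y(2)] by simp
    then have "(\<lambda>n. f (y n) + h * b - M * norm (w - y n) - M * (norm (x' - y n))\<^sup>2)
        \<longlonglongrightarrow> f w + h * b - M * norm (w - w) - M * (norm (x' - w))\<^sup>2"
      by (intro tendsto_intros y(2))
    ultimately have "f w + h * b - M * norm (w - w) - M * (norm (x' - w))\<^sup>2 \<le> f x'"
      using tendsto_le[OF sequentially_bot tendsto_const] by blast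
    then show ?thesis using u(1) h by (simp add: w_def)
  qed
  define \<rho> where "\<rho> = min r \<delta>"
  have \<rho>: "\<rho> > 0" using r u by (simp add: \<rho>_def)
  have "\<forall>\<^sub>F n in sequentially. dist (x n) a < \<rho> / 2"
    using x \<rho> by (intro tendstoD) auto
  moreover have "\<forall>\<^sub>F n in sequentially. e n < \<rho> / 2"
    using e(1) \<rho> by (intro order_tendstoD) auto
  ultimately have "\<forall>\<^sub>F n in sequentially. b \<le> t n + (C + M) * e n"
    using e(2) lb
  proof eventually_elim
    fix n assume n: "dist (x n) a < \<rho> / 2" "e n < \<rho> / 2" "0 < e n"
      "\<forall>z \<in> cball (x n) (e n). f (x n) - t n * e n - C * (e n)\<^sup>2 \<le> f z"
    let ?w = "x n - e n *\<^sub>R u"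
    have dw: "dist (x n) ?w = e n" using u(1) n(3) by (simp add: dist_norm)
    have "dist a ?w < \<rho>" using dist_triangle[of a ?w "x n"] n dw by (simp add: dist_commute)
    then have "f ?w + e n * b - M * (e n)\<^sup>2 \<le> f (x n)"
      using n \<rho> by (intro decr) (auto simp: \<rho>_def dist_commute)
    moreover have "f (x n) - t n * e n - C * (e n)\<^sup>2 \<le> f ?w" using n(4) dw by simp
    ultimately have "e n * b \<le> e n * (t n + (C + M) * e n)"
      by (simp add: algebra_simps power2_eq_square)
    then show "b \<le> t n + (C + M) * e n" using n(3) by simp
  qed
  moreover have "(\<lambda>n. t n + (C + M) * e n) \<longlonglongrightarrow> 0 + (C + M) * 0"
    by (intro tendsto_intros t e(1))
  ultimately have "b \<le> 0 + (C + M) * 0"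
    using tendsto_le[OF sequentially_bot _ tendsto_const] by blast
  then show False using u(2) by simp
qed

section \<open>The descent method\<close>

lemma sampling_returns_stop:
  "sampling_returns f x c \<epsilon> \<tau> \<theta> z \<Longrightarrow> (\<theta> - f x) / \<epsilon> > - \<tau> \<or> f z \<le> c * \<theta> + (1 - c) * f x"
  unfolding sampling_returns_def sampling_execution_def sampling_stop_def by blast

text \<open>The outer index starts at 1, and \<open>\<epsilon> j\<close> and \<open>\<tau> j\<close>
  are assumed positive only from there on.\<close>

lemma practical_descent_outer_pos:
  assumes "practical_descent f x0 c \<epsilon> \<tau> s L" "enat l \<le> L"
  shows "1 \<le> fst (s l)"
  using assms(2)
proof (induction l)
  case 0
  then show ?case using assms(1) by (simp add: practical_descent_def)
next
  case (Suc l)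
  then have lt: "enat l < L" by (simp add: Suc_ile_eq)
  then have "descent_pass f c \<epsilon> \<tau> (s l) (s (Suc l))"
    using assms(1) by (simp add: practical_descent_def)
  then show ?case using Suc.IH lt
    by (auto simp: descent_pass_def split: prod.splits if_splits)
qed

lemma practical_descent_infinite:
  assumes f: "locally_weakly_convex f" and "c < 1" "\<forall>j\<ge>1. 0 < \<epsilon> j" "\<forall>j\<ge>1. 0 < \<tau> j"
    and pd: "practical_descent f x0 c \<epsilon> \<tau> s L"
  shows "L = \<infinity>"
proof (rule ccontr)
  assume "L \<noteq> \<infinity>"
  then obtain l where l: "L = enat l" by auto
  obtain j i x where s: "s l = (j, i, x)" by (cases "s l")
  have "sampling_diverges f x c (\<epsilon> j) (\<tau> j)"
    using pd l s unfolding practical_descent_def by blast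
  moreover have "1 \<le> j"
    using practical_descent_outer_pos[OF pd, of l] l s by simp
  ultimately show False using sampling_terminates[OF f _ _ assms(2)] assms(3,4) by blast
qed

section \<open>Infinite runs: monotone values and finite stages\<close>

locale infinite_descent_run =
  fixes f :: "real^'n \<Rightarrow> real" and x0 :: "real^'n" and c :: real
    and \<epsilon> \<tau> :: "nat \<Rightarrow> real" and s :: "nat \<Rightarrow> 'n dstate"
  assumes f: "locally_weakly_convex f" and c: "0 < c" "c < 1"
    and \<epsilon>: "\<forall>j\<ge>1. 0 < \<epsilon> j" "\<epsilon> \<longlonglongrightarrow> 0" and \<tau>: "\<forall>j\<ge>1. 0 < \<tau> j" "\<tau> \<longlonglongrightarrow> 0"
    and pd: "practical_descent f x0 c \<epsilon> \<tau> s \<infinity>"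
    and level: "bounded {y. f y \<le> f x0}"
begin

abbreviation "outer l \<equiv> fst (s l)"
abbreviation "inner_ix l \<equiv> fst (snd (s l))"
abbreviation "X l \<equiv> all_iterates s l"

text \<open>The certificate left by the pass that closes stage \<open>j\<close>: some sampling call
  at \<open>x\<close> predicted too small a decrease.\<close>

definition null_step :: "real^'n \<Rightarrow> nat \<Rightarrow> bool" where
  "null_step x j \<longleftrightarrow> (\<exists>\<theta> z. sampling_returns f x c (\<epsilon> j) (\<tau> j) \<theta> z \<and> (\<theta> - f x) / \<epsilon> j > - \<tau> j)"

lemma cont: "continuous_on UNIV f"
  using f by (simp add: locally_weakly_convex_def)

lemma outer_pos: "1 \<le> outer l"
  using practical_descent_outer_pos[OF pd] by simp

text \<open>In a descent step the first stopping test fails, so \<open>\<theta> - f x\<close> is at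
  most \<open>- \<tau> j * \<epsilon> j\<close>, and sampling must have stopped through its
  sufficient decrease test, which realizes the fraction \<open>c\<close> of that decrease.\<close>

lemma step_cases:
  obtains (null) "outer (Suc l) = Suc (outer l)" "inner_ix (Suc l) = 0" "X (Suc l) = X l"
      "null_step (X l) (outer l)"
    | (descent) "outer (Suc l) = outer l" "inner_ix (Suc l) = Suc (inner_ix l)"
      "f (X (Suc l)) \<le> f (X l) - c * \<tau> (outer l) * \<epsilon> (outer l)"
proof -
  obtain j i x where s: "s l = (j, i, x)" by (cases "s l")
  have "descent_pass f c \<epsilon> \<tau> (s l) (s (Suc l))"
    using pd by (simp add: practical_descent_def)
  then obtain \<theta> z where ret: "sampling_returns f x c (\<epsilon> j) (\<tau> j) \<theta> z"
    and s': "s (Suc l) = (if (\<theta> - f x) / \<epsilon> j > - \<tau> j then (Suc j, 0, x) else (j, Suc i, z))"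
    unfolding descent_pass_def s by auto
  show thesis
  proof (cases "(\<theta> - f x) / \<epsilon> j > - \<tau> j")
    case True
    then show thesis
      using null ret s s' by (auto simp: all_iterates_def null_step_def)
  next
    case False
    have j: "0 < \<epsilon> j" using outer_pos[of l] \<epsilon>(1) s by simp
    have "f z \<le> c * \<theta> + (1 - c) * f x"
      using sampling_returns_stop[OF ret] False by blast
    also have "\<dots> = f x + c * (\<theta> - f x)" by (simp add: algebra_simps)
    also have "\<dots> \<le> f x + c * (- \<tau> j * \<epsilon> j)"
      using False j c by (intro add_left_mono mult_left_mono) (auto simp: field_simps)
    finally show thesis
      using descent False s s' by (auto simp: all_iterates_def)
  qed
qed

lemma step_pos: "0 < c * \<tau> (outer l) * \<epsilon> (outer l)"
  using outer_pos[of l] \<epsilon>(1) \<tau>(1) c by simp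

lemma decseq_values: "decseq (\<lambda>l. f (X l))"
proof (rule decseq_SucI)
  fix l
  show "f (X (Suc l)) \<le> f (X l)"
    using step_pos[of l] by (cases rule: step_cases[of l]) auto
qed

lemma in_level_set: "X l \<in> {y. f y \<le> f x0}"
proof -
  have "X 0 = x0" using pd by (simp add: practical_descent_def all_iterates_def)
  then show ?thesis using decseqD[OF decseq_values, of 0 l] by simp
qed

lemma compact_level_set: "compact {y. f y \<le> f x0}"
  using level by (simp add: compact_eq_bounded_closed closed_Collect_le cont)

lemma convergent_values: obtains v where "(\<lambda>l. f (X l)) \<longlonglongrightarrow> v"
proof -
  have "continuous_on {y. f y \<le> f x0} f" using cont by (rule continuous_on_subset) auto
  then obtain y where "\<forall>x\<in>{y. f y \<le> f x0}. f y \<le> f x"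
    using continuous_attains_inf[OF compact_level_set, of f] by blast
  then have "f y \<le> f (X l)" for l using in_level_set by blast
  then show thesis using decseq_convergent[OF decseq_values] that by blast
qed

text \<open>The values converge, so consecutive decreases eventually drop below the fixed amount
  that each descent step of stage \<open>j\<close> achieves.\<close>

lemma finite_descent_steps: "finite {l. outer l = j \<and> outer (Suc l) = j}" (is "finite ?P")
proof (cases "1 \<le> j")
  case True
  define \<delta> where "\<delta> = c * \<tau> j * \<epsilon> j"
  have \<delta>: "0 < \<delta>" using True \<epsilon>(1) \<tau>(1) c by (simp add: \<delta>_def)
  obtain v where v: "(\<lambda>l. f (X l)) \<longlonglongrightarrow> v" by (rule convergent_values)
  have "(\<lambda>l. f (X l) - f (X (Suc l))) \<longlonglongrightarrow> v - v"
    by (intro tendsto_diff v LIMSEQ_Suc[OF v])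
  then have "\<forall>\<^sub>F l in sequentially. f (X l) - f (X (Suc l)) < \<delta>"
    using \<delta> by (intro order_tendstoD(2)[of _ "v - v"]) auto
  then obtain N where N: "\<And>l. l \<ge> N \<Longrightarrow> f (X l) - f (X (Suc l)) < \<delta>"
    unfolding eventually_sequentially by blast
  have "l < N" if "l \<in> ?P" for l
  proof (cases rule: step_cases[of l])
    case descent
    then show ?thesis using N[of l] that by (force simp: \<delta>_def)
  qed (use that in auto)
  then show ?thesis using finite_nat_set_iff_bounded by blast
next
  case False
  then have "l \<notin> ?P" for l using outer_pos[of l] by auto
  then have "?P = {}" by blast
  then show ?thesis by (simp only: finite.emptyI)
qed

section \<open>Stages and outer iterates\<close>

lemma incseq_outer: "incseq outer"
proof (rule incseq_SucI)
  show "outer l \<le> outer (Suc l)" for l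
    by (cases rule: step_cases[of l]) auto
qed

lemma next_outer:
  assumes "outer l = j"
  obtains k where "outer k = j" "outer (Suc k) = Suc j" "inner_ix (Suc k) = 0" "X (Suc k) = X k"
    "null_step (X k) j"
proof -
  have "\<exists>k\<ge>l. outer k \<noteq> j"
  proof (rule ccontr)
    assume "\<not> ?thesis"
    then have "{l..} \<subseteq> {l. outer l = j \<and> outer (Suc l) = j}" by auto
    then show False using finite_descent_steps infinite_Ici finite_subset by blast
  qed
  then have ex: "\<exists>k. l \<le> k \<and> outer k \<noteq> j" by blast
  \<comment> \<open>The first exit from stage \<open>j\<close>. It comes after \<open>l\<close>, so
    its predecessor \<open>k\<close> is still in the stage, and only a null step can leave
    it.\<close>
  define m where "m = (LEAST k. l \<le> k \<and> outer k \<noteq> j)"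
  have m: "l \<le> m" "outer m \<noteq> j" using LeastI_ex[OF ex] by (auto simp: m_def)
  then obtain k where k: "m = Suc k" "l \<le> k" using assms by (cases m) (auto simp: le_Suc_eq)
  have kj: "outer k = j" using not_less_Least[of k "\<lambda>k. l \<le> k \<and> outer k \<noteq> j"] k by (auto simp: m_def)
  show thesis
  proof (cases rule: step_cases[of k])
    case null
    then show thesis using that kj by simp
  next
    case descent
    then show thesis using m(2) k kj by simp
  qed
qed

text \<open>A null step keeps the iterate, so the certificate for stage \<open>j\<close> holds at
  the first point of stage \<open>Suc j\<close>. The first stage starts at \<open>x0\<close> without
  one, hence the guard.\<close>

lemma stage_start:
  "\<exists>l. outer l = Suc j \<and> inner_ix l = 0 \<and> (1 \<le> j \<longrightarrow> null_step (X l) j)"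
proof (induction j)
  case 0
  then show ?case using pd by (intro exI[of _ 0]) (simp add: practical_descent_def)
next
  case (Suc j)
  then obtain l where "outer l = Suc j" by blast
  then obtain k where "outer (Suc k) = Suc (Suc j)" "inner_ix (Suc k) = 0" "X (Suc k) = X k"
    "null_step (X k) (Suc j)" using next_outer by metis
  then show ?case by (intro exI[of _ "Suc k"]) simp
qed

text \<open>A later state of the same stage is reached by a descent step, which makes the inner
  index positive. This justifies the definite description in \<open>iterate\<close>.\<close>

lemma stage_start_unique:
  assumes "outer l = outer l'" "inner_ix l = 0" "inner_ix l' = 0"
  shows "l = l'"
proof -
  have False if "l < l'" "outer l = outer l'" "inner_ix l' = 0" for l l'
  proof -
    obtain k where k: "l' = Suc k" "l \<le> k" using \<open>l < l'\<close> by (cases l') auto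
    have "outer l \<le> outer k" "outer k \<le> outer l'"
      using k by (auto intro: incseqD[OF incseq_outer])
    then have "outer (Suc k) = outer k" using that k by simp
    then show False using that(3) k by (cases rule: step_cases[of k]) auto
  qed
  then show ?thesis using assms by (metis nat_neq_iff)
qed

lemma outer_iterate_eq:
  assumes "outer l = Suc j" "inner_ix l = 0"
  shows "outer_iterate s \<infinity> j = X l"
proof -
  have sl: "s l = (Suc j, 0, X l)"
    using assms by (cases "s l") (simp add: all_iterates_def)
  show ?thesis
    unfolding outer_iterate_def iterate_def
  proof (rule the_equality)
    show "\<exists>k. enat k \<le> \<infinity> \<and> s k = (Suc j, 0, X l)"
      using sl by (intro exI[of _ l]) simp
  next
    fix x assume "\<exists>l. enat l \<le> \<infinity> \<and> s l = (Suc j, 0, x)"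
    then obtain l' where l': "s l' = (Suc j, 0, x)" by blast
    then have "l' = l" using stage_start_unique[of l' l] assms by simp
    then show "x = X l" using sl l' by simp
  qed
qed

text \<open>The outer iterates form a subsequence of all iterates: \<open>T j\<close> is the start
  of stage \<open>Suc j\<close>, and index 0 stands for \<open>x0\<close>.\<close>

lemma stage_starts:
  "\<exists>T. strict_mono T \<and> (\<forall>j. outer_iterate s \<infinity> j = X (T j) \<and>
     (1 \<le> j \<longrightarrow> null_step (outer_iterate s \<infinity> j) j))"
proof -
  obtain T where T: "\<And>j. outer (T j) = Suc j" "\<And>j. inner_ix (T j) = 0"
    "\<And>j. 1 \<le> j \<Longrightarrow> null_step (X (T j)) j"
    using stage_start by metis
  have "T j < T (Suc j)" for j
    using incseqD[OF incseq_outer, of "T (Suc j)" "T j"] T(1)[of j] T(1)[of "Suc j"] by linarith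
  then have "strict_mono T" by (simp add: strict_mono_Suc_iff)
  then show ?thesis
    using T(3) by (intro exI[of _ T]) (simp add: outer_iterate_eq[OF T(1,2)])
qed

section \<open>Accumulation points\<close>

lemma accumulation_point_exists: "\<exists>a. accumulation_point (outer_iterate s \<infinity>) a"
proof -
  obtain T where "\<And>j. outer_iterate s \<infinity> j = X (T j)" using stage_starts by blast
  then have "\<forall>j. outer_iterate s \<infinity> j \<in> {y. f y \<le> f x0}" using in_level_set by simp
  then show ?thesis
    using compact_level_set unfolding compact_def accumulation_point_def by metis
qed

text \<open>The values along the full run already converge; a subsequence of outer iterates merely
  identifies the limit by continuity.\<close>

lemma values_tendsto:
  assumes "accumulation_point (outer_iterate s \<infinity>) a"
  shows "(\<lambda>l. f (X l)) \<longlonglongrightarrow> f a"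
proof -
  obtain T where T: "strict_mono T" "\<And>j. outer_iterate s \<infinity> j = X (T j)" using stage_starts by blast
  obtain p where p: "strict_mono p" and a: "(outer_iterate s \<infinity> \<circ> p) \<longlonglongrightarrow> a"
    using assms unfolding accumulation_point_def by blast
  obtain v where v: "(\<lambda>l. f (X l)) \<longlonglongrightarrow> v" by (rule convergent_values)
  have "(\<lambda>k. f (X (T (p k)))) \<longlonglongrightarrow> f a"
    using continuous_on_tendsto_compose[OF cont a] T(2) by simp
  moreover have "(\<lambda>k. f (X (T (p k)))) \<longlonglongrightarrow> v"
    using LIMSEQ_subseq_LIMSEQ[OF v strict_mono_o[OF T(1) p]] by (simp add: o_def)
  ultimately show ?thesis using v LIMSEQ_unique by blast
qed

lemma accumulation_point_critical:
  assumes "accumulation_point (outer_iterate s \<infinity>) a"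
  shows "critical_point f a"
proof -
  obtain p where p: "strict_mono p" and a: "(outer_iterate s \<infinity> \<circ> p) \<longlonglongrightarrow> a"
    using assms unfolding accumulation_point_def by blast
  have ns: "null_step (outer_iterate s \<infinity> j) j" if "1 \<le> j" for j
    using stage_starts that by blast
  obtain r C where r: "0 < r" "0 \<le> C" and lb:
    "\<And>x c \<epsilon> \<tau> \<theta> w z. \<lbrakk>dist a x < r; 0 \<le> \<epsilon>; \<epsilon> < r; sampling_returns f x c \<epsilon> \<tau> \<theta> w; z \<in> cball x \<epsilon>\<rbrakk>
       \<Longrightarrow> \<theta> \<le> f z + C * \<epsilon>\<^sup>2"
    by (rule sampling_returns_lower_bound[OF f, of a]) (rule that)
  have e0: "(\<epsilon> \<circ> p) \<longlonglongrightarrow> 0" and t0: "(\<tau> \<circ> p) \<longlonglongrightarrow> 0"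
    using LIMSEQ_subseq_LIMSEQ[OF _ p] \<epsilon>(2) \<tau>(2) by blast+
  have "1 \<le> p n" if "1 \<le> n" for n using seq_suble[OF p, of n] that by simp
  \<comment> \<open>Index 0 has to be avoided: there is no null step for it, and the sign of
    \<open>\<epsilon> 0\<close> is not prescribed.\<close>
  then have p1: "\<forall>\<^sub>F n in sequentially. 1 \<le> p n"
    unfolding eventually_sequentially by blast
  then have epos: "\<forall>\<^sub>F n in sequentially. 0 < (\<epsilon> \<circ> p) n"
    by eventually_elim (simp add: \<epsilon>(1))
  have "\<forall>\<^sub>F n in sequentially. dist ((outer_iterate s \<infinity> \<circ> p) n) a < r"
    using r by (intro tendstoD[OF a])
  moreover have "\<forall>\<^sub>F n in sequentially. (\<epsilon> \<circ> p) n < r"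
    using r by (intro order_tendstoD(2)[OF e0])
  ultimately have "\<forall>\<^sub>F n in sequentially. \<forall>z \<in> cball ((outer_iterate s \<infinity> \<circ> p) n) ((\<epsilon> \<circ> p) n).
      f ((outer_iterate s \<infinity> \<circ> p) n) - (\<tau> \<circ> p) n * (\<epsilon> \<circ> p) n - C * ((\<epsilon> \<circ> p) n)\<^sup>2 \<le> f z"
    using p1 epos
  proof eventually_elim
    fix n
    let ?x = "outer_iterate s \<infinity> (p n)"
    assume n: "dist ((outer_iterate s \<infinity> \<circ> p) n) a < r" "(\<epsilon> \<circ> p) n < r" "1 \<le> p n" "0 < (\<epsilon> \<circ> p) n"
    obtain \<theta> w where ret: "sampling_returns f ?x c (\<epsilon> (p n)) (\<tau> (p n)) \<theta> w"
      and th: "(\<theta> - f ?x) / \<epsilon> (p n) > - \<tau> (p n)"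
      using ns[OF n(3)] unfolding null_step_def by blast
    have "f ?x - \<tau> (p n) * \<epsilon> (p n) < \<theta>" using th n(4) by (simp add: field_simps)
    moreover have "\<theta> \<le> f z + C * (\<epsilon> (p n))\<^sup>2" if "z \<in> cball ?x (\<epsilon> (p n))" for z
      using n that by (intro lb[OF _ _ _ ret that]) (auto simp: dist_commute)
    ultimately show "\<forall>z \<in> cball ((outer_iterate s \<infinity> \<circ> p) n) ((\<epsilon> \<circ> p) n).
      f ((outer_iterate s \<infinity> \<circ> p) n) - (\<tau> \<circ> p) n * (\<epsilon> \<circ> p) n - C * ((\<epsilon> \<circ> p) n)\<^sup>2 \<le> f z"
      by force
  qed
  then show ?thesis
    by (rule critical_point_of_approximate_minimizers[OF f a e0 epos t0])
qed

end

text \<open>The first two conjuncts of the conclusion ensure that the run and every stage behave as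
  intended, so that the outer iterates really form an infinite sequence.\<close>

theorem theorem13:
  fixes f :: "real^'n \<Rightarrow> real" and x0 :: "real^'n" and c :: real
    and \<epsilon> \<tau> :: "nat \<Rightarrow> real" and s :: "nat \<Rightarrow> 'n dstate" and L :: enat
  assumes "(convex_on UNIV f \<and> locally_lipschitz f \<and> Omega2 f \<in> null_sets lebesgue \<and>
            (\<forall>x. \<exists>V. open V \<and> x \<in> V \<and> bounded (hessian f ` (V - Omega2 f))))
         \<or> ((\<exists>(I :: nat set) g. finite I \<and> I \<noteq> {} \<and> (\<forall>k\<in>I. C3 (g k)) \<and>
               (\<forall>x. f x = Max ((\<lambda>k. g k x) ` I))) \<and>
            (\<forall>x. f differentiable (at x) \<longrightarrow> C2_at f x))"
    and "0 < c" and "c < 1"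
    and "\<forall>j\<ge>1. 0 < \<epsilon> j" and "\<epsilon> \<longlonglongrightarrow> 0"
    and "\<forall>j\<ge>1. 0 < \<tau> j" and "\<tau> \<longlonglongrightarrow> 0"
    and "practical_descent f x0 c \<epsilon> \<tau> s L"
    and "bounded {y. f y \<le> f x0}"
  shows "L = \<infinity> \<and> (\<forall>j\<ge>1. num_descent_steps s L j \<noteq> \<infinity>) \<and>
    (\<exists>xs. accumulation_point (outer_iterate s L) xs) \<and>
    (\<forall>xs. accumulation_point (outer_iterate s L) xs \<longrightarrow>
       critical_point f xs \<and> (\<lambda>l. f (all_iterates s l)) \<longlonglongrightarrow> f xs)"
proof -
  have f: "locally_weakly_convex f"
    using assms(1)
  proof (elim disjE conjE exE)
    fix I :: "nat set" and g
    assume "finite I" "I \<noteq> {}" "\<forall>k\<in>I. C3 (g k)" "\<forall>x. f x = Max ((\<lambda>k. g k x) ` I)"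
      "\<forall>x. f differentiable (at x) \<longrightarrow> C2_at f x"
    then show ?thesis by (intro locally_weakly_convex_max_type[of I g]) auto
  qed (rule locally_weakly_convex_convex)
  have L: "L = \<infinity>"
    by (rule practical_descent_infinite[OF f assms(3,4,6,8)])
  interpret infinite_descent_run f x0 c \<epsilon> \<tau> s
    using f assms L by unfold_locales auto
  have "num_descent_steps s L j \<noteq> \<infinity>" for j
    using finite_descent_steps[of j] by (simp add: num_descent_steps_def L)
  then show ?thesis
    using L accumulation_point_exists accumulation_point_critical values_tendsto by simp
qed

end
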